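(* Let $\Bbbk$ be an algebraically closed field of characteristic $0$, $S:=\Bbbk[x,y,z,w]$, let $n_1,n_2\ge 3$ be integers, $I:=\langle x,y\rangle^{n_1}+\langle z,w\rangle^{n_2}+\langle xz-yw\rangle$, and $A:=S/I$. Let $s_1,s_2,\dotsc,s_r\in S$ (with $r\geq 1$), \[ J'=I+\langle s_1,s_2,\dotsc,s_r\rangle \] and $B'=S/J'$. Assume every $s_i+I\in\mathrm{Soc}\,A$ and $\mathrm{Soc}\,B'=B'_{(n_1-1,n_2-1)}$. Then $J'$ has trivial negative tangents.
   Context: $S$ is bigraded by letting $x^{u_1}y^{u_2}z^{u_3}w^{u_4}$ have bidegree $(u_1+u_2,u_3+u_4)$; the standard grading is the total degree. $I$ and $J'$ are bigraded, and $B'_{(i,j)}$ is the bidegree $(i,j)$ piece of $B'$. The socle of a local Artinian ring is the annihilator of its maximal ideal. A homogeneous ideal $J'\subset S$ supported at the origin, with $B'=S/J'$, has trivial negative tangents if $T^1(B'/\Bbbk,B')_{<0}=0$; here $T^1(B'/\Bbbk,B')$ is the first tangent cohomology module (with its standard $\mathbb{Z}$-grading), i.e. the cokernel of the natural map $\mathrm{Der}_{\Bbbk}(S,B')\to\mathrm{Hom}_S(J',B')$. Equivalently, the space $\mathrm{Hom}_S(J',S/J')_{<0}$ of homomorphisms of negative degree is the $\Bbbk$-span of the trivial tangents $\partial_x,\partial_y,\partial_z,\partial_w$, where $\partial_x(f)=\frac{\partial f}{\partial x}+J'$ for $f\in J'$, and similarly for $y,z,w$. *)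

theory Defs
  imports
    "HOL-Library.Poly_Mapping"
    "HOL-Computational_Algebra.Polynomial"
    "HOL-Algebra.QuotRing"
    "HOL-Algebra.Ideal_Product"
begin

text \<open>
  The polynomial ring \<open>S = k[x,y,z,w]\<close>. A monomial is its exponent vector, a polynomial is a finitely
  supported map from monomials to coefficients; the product of \<^theory>\<open>HOL-Library.Poly_Mapping\<close>
  is then the product of polynomials.
\<close>

datatype indet = IX | IY | IZ | IW

type_synonym 'k poly4 = "(indet \<Rightarrow>\<^sub>0 nat) \<Rightarrow>\<^sub>0 'k"

definition indet_poly :: "indet \<Rightarrow> 'k::field poly4" where
  "indet_poly v = Poly_Mapping.single (Poly_Mapping.single v 1) 1"

definition const_poly :: "'k::field \<Rightarrow> 'k poly4" where
  "const_poly c = Poly_Mapping.single 0 c"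

definition S_ring :: "'k::field poly4 ring" where
  "S_ring = \<lparr>carrier = UNIV, mult = (*), one = 1, zero = 0, add = (+)\<rparr>"


definition bideg_part :: "nat \<Rightarrow> nat \<Rightarrow> 'k::field poly4 set" where
  "bideg_part i j = {f. \<forall>m \<in> Poly_Mapping.keys f.
     poly_mapping.lookup m IX + poly_mapping.lookup m IY = i \<and>
     poly_mapping.lookup m IZ + poly_mapping.lookup m IW = j}"

text \<open>Degrees are integers so that degree shifts can be negative; \<open>S\<^sub>d = 0\<close> for \<open>d < 0\<close>.\<close>

definition deg_part :: "int \<Rightarrow> 'k::field poly4 set" where
  "deg_part d = {f. \<forall>m \<in> Poly_Mapping.keys f.
     int (poly_mapping.lookup m IX + poly_mapping.lookup m IY
          + poly_mapping.lookup m IZ + poly_mapping.lookup m IW) = d}"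

text \<open>
  For an ideal \<open>J\<close> that is homogeneous for the grading in question, the graded pieces of \<open>S/J\<close> are the
  images of the graded pieces of \<open>S\<close>.
\<close>

definition quot_bideg_part :: "'k::field poly4 set \<Rightarrow> nat \<Rightarrow> nat \<Rightarrow> 'k poly4 set set" where
  "quot_bideg_part J i j = (\<lambda>f. J +>\<^bsub>S_ring\<^esub> f) ` bideg_part i j"

definition quot_deg_part :: "'k::field poly4 set \<Rightarrow> int \<Rightarrow> 'k poly4 set set" where
  "quot_deg_part J d = (\<lambda>f. J +>\<^bsub>S_ring\<^esub> f) ` deg_part d"


text \<open>The ideal \<open>\<langle>x,y\<rangle>\<^bsup>n1\<^esup> + \<langle>z,w\<rangle>\<^bsup>n2\<^esup> + \<langle>xz - yw\<rangle>\<close>.\<close>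

definition ideal_I :: "nat \<Rightarrow> nat \<Rightarrow> 'k::field poly4 set" where
  "ideal_I n1 n2 =
     (Idl\<^bsub>S_ring\<^esub> {indet_poly IX, indet_poly IY}) [^]\<^bsub>ideals_set S_ring\<^esub> n1
     <+>\<^bsub>S_ring\<^esub> (Idl\<^bsub>S_ring\<^esub> {indet_poly IZ, indet_poly IW}) [^]\<^bsub>ideals_set S_ring\<^esub> n2
     <+>\<^bsub>S_ring\<^esub> Idl\<^bsub>S_ring\<^esub> {indet_poly IX * indet_poly IZ - indet_poly IY * indet_poly IW}"


text \<open>The socle of a local (Artinian) ring; the description of the maximal ideal presupposes that
  there is exactly one.\<close>

definition max_ideal :: "('a, 'b) ring_scheme \<Rightarrow> 'a set" where
  "max_ideal R = (THE M. maximalideal M R)"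

definition socle :: "('a, 'b) ring_scheme \<Rightarrow> 'a set" where
  "socle R = {a \<in> carrier R. \<forall>m \<in> max_ideal R. m \<otimes>\<^bsub>R\<^esub> a = \<zero>\<^bsub>R\<^esub>}"


text \<open>
  \<open>Hom\<^sub>S(J, S/J)\<close>, where \<open>a \<in> S\<close> acts on \<open>S/J\<close> through its class. Homomorphisms are extensional
  functions on \<open>J\<close>, so that equality of homomorphisms is equality of functions.
\<close>

definition tangents :: "'k::field poly4 set \<Rightarrow> ('k poly4 \<Rightarrow> 'k poly4 set) set" where
  "tangents J = {\<phi> \<in> J \<rightarrow>\<^sub>E carrier (S_ring Quot J).
     (\<forall>f\<in>J. \<forall>g\<in>J. \<phi> (f + g) = \<phi> f \<oplus>\<^bsub>S_ring Quot J\<^esub> \<phi> g) \<and>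
     (\<forall>a. \<forall>f\<in>J. \<phi> (a * f) = (J +>\<^bsub>S_ring\<^esub> a) \<otimes>\<^bsub>S_ring Quot J\<^esub> \<phi> f)}"

definition tangent_group :: "'k::field poly4 set \<Rightarrow> ('k poly4 \<Rightarrow> 'k poly4 set) monoid" where
  "tangent_group J =
     \<lparr>carrier = tangents J,
      mult = (\<lambda>\<phi> \<psi>. \<lambda>f\<in>J. \<phi> f \<oplus>\<^bsub>S_ring Quot J\<^esub> \<psi> f),
      one = (\<lambda>f\<in>J. \<zero>\<^bsub>S_ring Quot J\<^esub>)\<rparr>"

definition tangents_deg :: "'k::field poly4 set \<Rightarrow> int \<Rightarrow> ('k poly4 \<Rightarrow> 'k poly4 set) set" where
  "tangents_deg J d =
     {\<phi> \<in> tangents J. \<forall>e. \<forall>f \<in> J \<inter> deg_part e. \<phi> f \<in> quot_deg_part J (e + d)}"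

text \<open>\<open>Der\<^sub>k(S, S/J)\<close>.\<close>

definition derivations :: "'k::field poly4 set \<Rightarrow> ('k poly4 \<Rightarrow> 'k poly4 set) set" where
  "derivations J = {D \<in> UNIV \<rightarrow> carrier (S_ring Quot J).
     (\<forall>f g. D (f + g) = D f \<oplus>\<^bsub>S_ring Quot J\<^esub> D g) \<and>
     (\<forall>c f. D (const_poly c * f) = (J +>\<^bsub>S_ring\<^esub> const_poly c) \<otimes>\<^bsub>S_ring Quot J\<^esub> D f) \<and>
     (\<forall>f g. D (f * g) =
        (J +>\<^bsub>S_ring\<^esub> f) \<otimes>\<^bsub>S_ring Quot J\<^esub> D g
        \<oplus>\<^bsub>S_ring Quot J\<^esub> (J +>\<^bsub>S_ring\<^esub> g) \<otimes>\<^bsub>S_ring Quot J\<^esub> D f)}"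

text \<open>
  \<open>T\<^sup>1\<close> of \<open>S/J\<close> is the cokernel of the map \<open>D \<mapsto> D|\<^sub>J\<close> from derivations to homomorphisms; only its
  underlying abelian group and its grading are recorded. Its degree \<open>d\<close> piece is the image of the
  homomorphisms of degree \<open>d\<close>.
\<close>

definition trivial_tangents :: "'k::field poly4 set \<Rightarrow> ('k poly4 \<Rightarrow> 'k poly4 set) set" where
  "trivial_tangents J = (\<lambda>D. restrict D J) ` derivations J"

definition T1 :: "'k::field poly4 set \<Rightarrow> ('k poly4 \<Rightarrow> 'k poly4 set) set monoid" where
  "T1 J = tangent_group J Mod trivial_tangents J"

definition T1_deg ::
    "'k::field poly4 set \<Rightarrow> int \<Rightarrow> ('k poly4 \<Rightarrow> 'k poly4 set) set set" where
  "T1_deg J d = (\<lambda>\<phi>. trivial_tangents J #>\<^bsub>tangent_group J\<^esub> \<phi>) ` tangents_deg J d"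

text \<open>The notion is meant for homogeneous ideals \<open>J\<close> supported at the origin. The negative part
  of \<open>T\<^sup>1\<close> vanishes iff each of its graded pieces does.\<close>

definition trivial_negative_tangents :: "'k::field poly4 set \<Rightarrow> bool" where
  "trivial_negative_tangents J \<longleftrightarrow> (\<forall>d<0. T1_deg J d = {\<one>\<^bsub>T1 J\<^esub>})"

end

theory Submission
  imports Defs
begin

text \<open>
  Write \<open>V(D)\<close> (\<open>vanish_ideal\<close>) for the ideal of polynomials that vanish modulo \<open>xz - yw\<close> in
  every bidegree of \<open>D\<close>. The ring \<open>S/(xz - yw)\<close> is the toric ring generated by \<open>su, sv, tv, tu\<close> (for \<open>x, y, z, w\<close>): its piece
  of bidegree \<open>(i, j)\<close> is a copy of the binary forms of degree \<open>i + j\<close> in \<open>u, v\<close>, on which \<open>x\<close> and \<open>w\<close>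
  act as \<open>u\<close>, and \<open>y\<close> and \<open>z\<close> as \<open>v\<close>. The ideal \<open>I\<close> consists of the polynomials that vanish in
  this ring in all bidegrees of the box \<open>i < n1\<close>, \<open>j < n2\<close> (\<open>ideal_I_eq_vanish\<close>). Multiplication by
  \<open>v\<close> is injective on binary forms, so the socle of \<open>A\<close> sits in the corner \<open>(n1 - 1, n2 - 1)\<close> of the
  box, and \<open>J'\<close> differs from \<open>I\<close> in this corner only.

  Let \<open>\<phi>\<close> be a homomorphism \<open>J' \<rightarrow> S/J'\<close> of degree \<open>d < 0\<close>. The syzygies
  \<open>y \<cdot> x\<^sup>a\<^sup>+\<^sup>1y\<^sup>b = x \<cdot> x\<^sup>ay\<^sup>b\<^sup>+\<^sup>1\<close> say that the binary forms \<open>F\<^sub>a\<close> representing \<open>\<phi>(x\<^sup>ay\<^sup>n\<^sup>1\<^sup>-\<^sup>a)\<close> satisfy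
  \<open>v F\<^sub>a\<^sub>+\<^sub>1 = u F\<^sub>a\<close>. Hence \<open>u\<close> to the power \<open>n1\<close> divides \<open>F\<close> at \<open>a = n1\<close>, which has degree
  \<open>n1 + d < n1\<close>, so all of them are zero (\<open>chain_zero\<close>). The corner never interferes, as its total
  degree is too large for \<open>n1, n2 \<ge> 3\<close>. The only bidegree out of reach of this argument is
  \<open>(n1 - 1, 0)\<close> with \<open>d = - 1\<close>, since \<open>x\<close> and \<open>y\<close> kill it. There the syzygies
  \<open>z \<cdot> x\<^sup>a\<^sup>+\<^sup>1y\<^sup>b - w \<cdot> x\<^sup>ay\<^sup>b\<^sup>+\<^sup>1 = x\<^sup>ay\<^sup>b \<cdot> (xz - yw)\<close> give the same recursion, once \<open>\<phi>(xz - yw) = 0\<close>.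
  For \<open>d = - 1\<close> that can be arranged: \<open>\<phi>(xz - yw)\<close> is a linear form, the partial derivatives of
  \<open>xz - yw\<close> are up to sign the four variables, and so some constant-coefficient derivation agrees with
  \<open>\<phi>\<close> on \<open>xz - yw\<close> and may be subtracted. Exchanging \<open>x, w\<close> and \<open>y, z\<close> gives the same for the monomials
  in \<open>z, w\<close>. For \<open>d < - 1\<close> nothing needs to be subtracted: \<open>\<phi>(xz - yw)\<close> is a constant killed by a power
  of \<open>x\<close> below \<open>n1\<close>, hence zero.

  So \<open>\<phi>\<close> vanishes on \<open>I\<close>. As the variables multiply \<open>J'\<close> into \<open>I\<close>, the values of \<open>\<phi>\<close> lie in the socle of
  \<open>S/J'\<close>, which by hypothesis has degree \<open>n1 + n2 - 2\<close>; but \<open>J'/I\<close> has that degree already and \<open>\<phi>\<close>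
  lowers degrees. Hence \<open>\<phi> = 0\<close> (\<open>negative_hom_lift_zero\<close>).

  Homomorphisms into \<open>S/J'\<close> are handled through lifts \<open>\<psi> : S \<rightarrow> S\<close> that are additive and linear modulo
  \<open>J'\<close>.
\<close>

section \<open>Ideals, induction and gradings on polynomials in four variables\<close>

text \<open>
  This agrees with the ideals of \<open>S_ring\<close> (\<open>ideal_S_ring_iff\<close>), but speaks of the type class
  operations, for which the simplifier is set up.
\<close>

definition poly_ideal :: "'k::field poly4 set \<Rightarrow> bool" where
  "poly_ideal L \<longleftrightarrow> 0 \<in> L \<and> (\<forall>f\<in>L. \<forall>g\<in>L. f + g \<in> L) \<and> (\<forall>a. \<forall>f\<in>L. a * f \<in> L)"

lemma poly_idealI:
  assumes "0 \<in> L" "\<And>f g. f \<in> L \<Longrightarrow> g \<in> L \<Longrightarrow> f + g \<in> L" "\<And>a f. f \<in> L \<Longrightarrow> a * f \<in> L"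
  shows "poly_ideal L"
  using assms by (simp add: poly_ideal_def)

lemma poly_ideal_zero: "poly_ideal L \<Longrightarrow> 0 \<in> L"
  and poly_ideal_add: "poly_ideal L \<Longrightarrow> f \<in> L \<Longrightarrow> g \<in> L \<Longrightarrow> f + g \<in> L"
  and poly_ideal_mult: "poly_ideal L \<Longrightarrow> f \<in> L \<Longrightarrow> a * f \<in> L"
  by (simp_all add: poly_ideal_def)

lemma poly_ideal_uminus: "poly_ideal L \<Longrightarrow> f \<in> L \<Longrightarrow> - f \<in> L"
  using poly_ideal_mult[of L f "- 1"] by simp

lemma poly_ideal_diff: "poly_ideal L \<Longrightarrow> f \<in> L \<Longrightarrow> g \<in> L \<Longrightarrow> f - g \<in> L"
  using poly_ideal_add[of L f "- g"] poly_ideal_uminus[of L g] by simp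

lemma poly_ideal_sum: "poly_ideal L \<Longrightarrow> (\<And>i. i \<in> A \<Longrightarrow> h i \<in> L) \<Longrightarrow> sum h A \<in> L"
  by (induction A rule: infinite_finite_induct) (auto intro: poly_ideal_zero poly_ideal_add)

lemma poly_ideal_mod_sym: "poly_ideal L \<Longrightarrow> f - g \<in> L \<Longrightarrow> g - f \<in> L"
  using poly_ideal_uminus[of L "f - g"] by simp

lemma poly_ideal_mod_trans: "poly_ideal L \<Longrightarrow> f - g \<in> L \<Longrightarrow> g - h \<in> L \<Longrightarrow> f - h \<in> L"
  using poly_ideal_add[of L "f - g" "g - h"] by simp

lemma poly_ideal_mod_mem: "poly_ideal L \<Longrightarrow> f - g \<in> L \<Longrightarrow> g \<in> L \<Longrightarrow> f \<in> L"
  using poly_ideal_add[of L "f - g" g] by simp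

lemma poly4_eq_sum_monomials:
  "(f :: 'k::field poly4) = (\<Sum>m\<in>Poly_Mapping.keys f. Poly_Mapping.single m (poly_mapping.lookup f m))"
  by (rule poly_mapping_eqI)
     (simp add: lookup_sum lookup_single when_def sum.delta' in_keys_iff)

lemma poly4_induct [case_names monomial add]:
  assumes mon: "\<And>m c. P (Poly_Mapping.single m c)"
    and add: "\<And>f g. P f \<Longrightarrow> P g \<Longrightarrow> P (f + g)"
  shows "P (f :: 'k::field poly4)"
proof -
  have "P (\<Sum>m\<in>A. Poly_Mapping.single m (poly_mapping.lookup f m))" if "finite A" for A
    using that
  proof (induction A)
    case empty
    then show ?case using mon[of 0 0] by simp
  qed (simp add: mon add)
  from this[OF finite_keys[of f]] show ?thesis
    using poly4_eq_sum_monomials[of f] by simp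
qed

definition xy_deg :: "(indet \<Rightarrow>\<^sub>0 nat) \<Rightarrow> nat" where
  "xy_deg m = poly_mapping.lookup m IX + poly_mapping.lookup m IY"

definition zw_deg :: "(indet \<Rightarrow>\<^sub>0 nat) \<Rightarrow> nat" where
  "zw_deg m = poly_mapping.lookup m IZ + poly_mapping.lookup m IW"

text \<open>
  Together with the bidegree this third degree, the exponent of \<open>u\<close> in the image under
  \<open>x, y, z, w \<mapsto> su, sv, tv, tu\<close>, determines the image of a monomial.
\<close>

definition xw_deg :: "(indet \<Rightarrow>\<^sub>0 nat) \<Rightarrow> nat" where
  "xw_deg m = poly_mapping.lookup m IX + poly_mapping.lookup m IW"

lemmas grading_defs = xy_deg_def zw_deg_def xw_deg_def

lemma grading_add:
  "xy_deg (m + n) = xy_deg m + xy_deg n"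
  "zw_deg (m + n) = zw_deg m + zw_deg n"
  "xw_deg (m + n) = xw_deg m + xw_deg n"
  by (simp_all add: grading_defs lookup_add)

lemma xw_deg_le: "xw_deg m \<le> xy_deg m + zw_deg m"
  by (simp add: grading_defs)

definition expo :: "nat \<Rightarrow> nat \<Rightarrow> nat \<Rightarrow> nat \<Rightarrow> indet \<Rightarrow>\<^sub>0 nat" where
  "expo a b c d = Poly_Mapping.single IX a + Poly_Mapping.single IY b
     + Poly_Mapping.single IZ c + Poly_Mapping.single IW d"

lemma lookup_expo [simp]:
  "poly_mapping.lookup (expo a b c d) IX = a"
  "poly_mapping.lookup (expo a b c d) IY = b"
  "poly_mapping.lookup (expo a b c d) IZ = c"
  "poly_mapping.lookup (expo a b c d) IW = d"
  by (simp_all add: expo_def lookup_add lookup_single)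

lemma grading_expo [simp]:
  "xy_deg (expo a b c d) = a + b" "zw_deg (expo a b c d) = c + d" "xw_deg (expo a b c d) = a + d"
  by (simp_all add: grading_defs)

lemma exponent_eqI:
  fixes m n :: "indet \<Rightarrow>\<^sub>0 nat"
  assumes "poly_mapping.lookup m IX = poly_mapping.lookup n IX"
    "poly_mapping.lookup m IY = poly_mapping.lookup n IY"
    "poly_mapping.lookup m IZ = poly_mapping.lookup n IZ"
    "poly_mapping.lookup m IW = poly_mapping.lookup n IW"
  shows "m = n"
proof (rule poly_mapping_eqI)
  show "poly_mapping.lookup m v = poly_mapping.lookup n v" for v
    using assms by (cases v) auto
qed

lemma expo_add: "expo a b c d + expo a' b' c' d' = expo (a + a') (b + b') (c + c') (d + d')"
  by (rule exponent_eqI) (simp_all add: lookup_add)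

lemma exponent_cases: obtains a b c d where "m = expo a b c d"
proof
  show "m = expo (poly_mapping.lookup m IX) (poly_mapping.lookup m IY)
    (poly_mapping.lookup m IZ) (poly_mapping.lookup m IW)"
    by (rule exponent_eqI) simp_all
qed

definition mon4 :: "nat \<Rightarrow> nat \<Rightarrow> nat \<Rightarrow> nat \<Rightarrow> 'k::field poly4" where
  "mon4 a b c d = Poly_Mapping.single (expo a b c d) 1"

lemma mon4_mult: "mon4 a b c d * mon4 a' b' c' d' = mon4 (a + a') (b + b') (c + c') (d + d')"
  by (simp add: mon4_def mult_single expo_add)

lemma indet_poly_eq_mon4:
  "indet_poly IX = mon4 1 0 0 0" "indet_poly IY = mon4 0 1 0 0"
  "indet_poly IZ = mon4 0 0 1 0" "indet_poly IW = mon4 0 0 0 1"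
  by (simp_all add: indet_poly_def mon4_def expo_def)

lemma mon4_0: "mon4 0 0 0 0 = 1"
  by (simp add: mon4_def expo_def)

lemma single_eq_const_mult: "Poly_Mapping.single m c = const_poly c * Poly_Mapping.single m 1"
  by (simp add: const_poly_def mult_single)

lemma const_poly_sum: "const_poly (sum c A) = (\<Sum>i\<in>A. const_poly (c i))"
  by (induction A rule: infinite_finite_induct) (simp_all add: const_poly_def single_add)

definition quadric :: "'k::field poly4" where
  "quadric = mon4 1 0 1 0 - mon4 0 1 0 1"

section \<open>Coefficients modulo the quadric\<close>

text \<open>
  The coefficient of \<open>u\<^sup>e\<close> in the binary form that represents the component of \<open>f\<close> of bidegree \<open>(i, j)\<close>
  after setting \<open>v = 1\<close>.
\<close>

definition toric_coeff :: "'k::field poly4 \<Rightarrow> nat \<Rightarrow> nat \<Rightarrow> nat \<Rightarrow> 'k" where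
  "toric_coeff f i j e = (\<Sum>m | m \<in> Poly_Mapping.keys f \<and> xy_deg m = i \<and> zw_deg m = j \<and> xw_deg m = e.
     poly_mapping.lookup f m)"

lemma toric_coeff_eq_sum:
  assumes "finite A" "Poly_Mapping.keys f \<subseteq> A"
  shows "toric_coeff f i j e = (\<Sum>m | m \<in> A \<and> xy_deg m = i \<and> zw_deg m = j \<and> xw_deg m = e.
     poly_mapping.lookup f m)"
  unfolding toric_coeff_def
  by (rule sum.mono_neutral_left) (use assms in \<open>auto simp: in_keys_iff\<close>)

lemma toric_coeff_add: "toric_coeff (f + g) i j e = toric_coeff f i j e + toric_coeff g i j e"
proof -
  let ?A = "Poly_Mapping.keys f \<union> Poly_Mapping.keys g"
  have "Poly_Mapping.keys (f + g) \<subseteq> ?A" by (rule keys_add)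
  then show ?thesis
    using toric_coeff_eq_sum[of ?A "f + g"] toric_coeff_eq_sum[of ?A f] toric_coeff_eq_sum[of ?A g]
    by (simp add: lookup_add sum.distrib)
qed

lemma toric_coeff_zero [simp]: "toric_coeff 0 i j e = 0"
  by (simp add: toric_coeff_def)

lemma toric_coeff_diff: "toric_coeff (f - g) i j e = toric_coeff f i j e - toric_coeff g i j e"
  using toric_coeff_add[of "f - g" g] by (simp add: algebra_simps)

lemma toric_coeff_single:
  "toric_coeff (Poly_Mapping.single m c) i j e = (if xy_deg m = i \<and> zw_deg m = j \<and> xw_deg m = e then c else 0)"
proof -
  have "toric_coeff (Poly_Mapping.single m c) i j e =
      (\<Sum>n | n \<in> {m} \<and> xy_deg n = i \<and> zw_deg n = j \<and> xw_deg n = e.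
        poly_mapping.lookup (Poly_Mapping.single m c) n)"
    by (rule toric_coeff_eq_sum) auto
  also have "{n. n \<in> {m} \<and> xy_deg n = i \<and> zw_deg n = j \<and> xw_deg n = e} =
      (if xy_deg m = i \<and> zw_deg m = j \<and> xw_deg m = e then {m} else {})" by auto
  finally show ?thesis by simp
qed

lemma toric_coeff_single_mult:
  "toric_coeff (Poly_Mapping.single m c * f) i j e =
     (if xy_deg m \<le> i \<and> zw_deg m \<le> j \<and> xw_deg m \<le> e
      then c * toric_coeff f (i - xy_deg m) (j - zw_deg m) (e - xw_deg m) else 0)"
proof (induction f rule: poly4_induct)
  case (monomial n c')
  then show ?case by (auto simp: mult_single toric_coeff_single grading_add)
next
  case (add f g)
  then show ?case by (auto simp: distrib_left toric_coeff_add)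
qed

lemma toric_coeff_mon4_mult:
  "toric_coeff (mon4 a b c d * f) i j e =
     (if a + b \<le> i \<and> c + d \<le> j \<and> a + d \<le> e
      then toric_coeff f (i - (a + b)) (j - (c + d)) (e - (a + d)) else 0)"
  by (simp add: mon4_def toric_coeff_single_mult)

lemma toric_coeff_mon4: "toric_coeff (mon4 a b c d) i j e = (if a + b = i \<and> c + d = j \<and> a + d = e then 1 else 0)"
  by (simp add: mon4_def toric_coeff_single)

lemma toric_coeff_eq_0_if_keys:
  assumes "\<And>m. m \<in> Poly_Mapping.keys f \<Longrightarrow> xy_deg m = i \<Longrightarrow> zw_deg m = j \<Longrightarrow> xw_deg m = e \<Longrightarrow> False"
  shows "toric_coeff f i j e = 0"
  unfolding toric_coeff_def by (rule sum.neutral) (use assms in auto)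

text \<open>
  The form in bidegree \<open>(i, j)\<close> has degree \<open>i + j\<close>, so no higher power of \<open>u\<close> occurs in it.
\<close>

lemma toric_coeff_large: "i + j < e \<Longrightarrow> toric_coeff f i j e = 0"
  by (rule toric_coeff_eq_0_if_keys) (use xw_deg_le in \<open>metis not_less\<close>)

lemma toric_coeff_bideg_part: "f \<in> bideg_part i' j' \<Longrightarrow> (i, j) \<noteq> (i', j') \<Longrightarrow> toric_coeff f i j e = 0"
  by (rule toric_coeff_eq_0_if_keys) (auto simp: bideg_part_def xy_deg_def zw_deg_def)

lemma deg_part_eq: "deg_part d = {f. \<forall>m\<in>Poly_Mapping.keys f. int (xy_deg m + zw_deg m) = d}"
  by (simp add: deg_part_def xy_deg_def zw_deg_def add.assoc)

lemma toric_coeff_deg_part: "f \<in> deg_part d \<Longrightarrow> int (i + j) \<noteq> d \<Longrightarrow> toric_coeff f i j e = 0"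
  by (rule toric_coeff_eq_0_if_keys) (auto simp: deg_part_eq)

definition vanish_ideal :: "(nat \<times> nat) set \<Rightarrow> 'k::field poly4 set" where
  "vanish_ideal D = {f. \<forall>(i, j)\<in>D. \<forall>e. toric_coeff f i j e = 0}"

lemma vanish_idealD: "f \<in> vanish_ideal D \<Longrightarrow> (i, j) \<in> D \<Longrightarrow> toric_coeff f i j e = 0"
  by (auto simp: vanish_ideal_def)

lemma vanish_idealI: "(\<And>i j e. (i, j) \<in> D \<Longrightarrow> toric_coeff f i j e = 0) \<Longrightarrow> f \<in> vanish_ideal D"
  by (auto simp: vanish_ideal_def)

text \<open>
  Multiplication by a monomial only raises bidegrees, so a component of \<open>a * f\<close> in \<open>D\<close> comes from
  components of \<open>f\<close> that lie in \<open>D\<close> as well.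
\<close>

lemma poly_ideal_vanish_ideal:
  assumes down: "\<And>i j i' j'. (i, j) \<in> D \<Longrightarrow> i' \<le> i \<Longrightarrow> j' \<le> j \<Longrightarrow> (i', j') \<in> D"
  shows "poly_ideal (vanish_ideal D)"
proof (rule poly_idealI)
  show "a * f \<in> vanish_ideal D" if "f \<in> vanish_ideal D" for a f :: "'k::field poly4"
  proof (induction a rule: poly4_induct)
    case (monomial m c)
    show ?case
      by (rule vanish_idealI)
         (auto simp: toric_coeff_single_mult intro!: vanish_idealD[OF that] intro: down)
  next
    case (add a b)
    then show ?case by (auto simp: distrib_right toric_coeff_add vanish_idealD intro!: vanish_idealI)
  qed
qed (auto simp: toric_coeff_add vanish_idealD intro!: vanish_idealI)

lemma mon4_mem_ideal_mono:
  assumes L: "poly_ideal L" and m: "mon4 a b c d \<in> L" and "a \<le> a'" "b \<le> b'" "c \<le> c'" "d \<le> d'"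
  shows "mon4 a' b' c' d' \<in> L"
  using poly_ideal_mult[OF L m, of "mon4 (a' - a) (b' - b) (c' - c) (d' - d)"] assms
  by (simp add: mon4_mult)

lemma mon4_mod_quadric:
  assumes L: "poly_ideal L" and q: "quadric \<in> L"
  shows "mon4 (a + k) b (c + k) d - mon4 a (b + k) c (d + k) \<in> L"
proof (induction k arbitrary: b d)
  case 0
  then show ?case using L by (simp add: poly_ideal_zero)
next
  case (Suc k)
  have "mon4 (a + k) b (c + k) d * quadric \<in> L" by (rule poly_ideal_mult[OF L q])
  then have "mon4 (a + Suc k) b (c + Suc k) d - mon4 (a + k) (Suc b) (c + k) (Suc d) \<in> L"
    by (simp add: quadric_def right_diff_distrib mon4_mult)
  from poly_ideal_mod_trans[OF L this Suc.IH[of "Suc b" "Suc d"]] show ?case by simp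
qed

text \<open>
  The exponent reached from any monomial of bidegree \<open>(i, j)\<close> and third degree \<open>e\<close> by replacing \<open>xz\<close>
  by \<open>yw\<close> as often as possible.
\<close>

definition normal_exponent :: "nat \<Rightarrow> nat \<Rightarrow> nat \<Rightarrow> indet \<Rightarrow>\<^sub>0 nat" where
  "normal_exponent i j e = (if e \<le> j then expo 0 i (j - e) e else expo (e - j) (i + j - e) 0 j)"

lemma single_mod_quadric:
  assumes L: "poly_ideal L" and q: "quadric \<in> L"
  shows "Poly_Mapping.single m k - Poly_Mapping.single (normal_exponent (xy_deg m) (zw_deg m) (xw_deg m)) k \<in> L"
proof -
  obtain a b c d where m: "m = expo a b c d" by (rule exponent_cases)
  have "mon4 a b c d - Poly_Mapping.single (normal_exponent (a + b) (c + d) (a + d)) 1 \<in> L"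
  proof (cases "a \<le> c")
    case True
    then show ?thesis
      using mon4_mod_quadric[OF L q, of 0 a b "c - a" d]
      by (simp add: normal_exponent_def mon4_def add.commute)
  next
    case False
    then show ?thesis
      using mon4_mod_quadric[OF L q, of "a - c" c b 0 d]
      by (simp add: normal_exponent_def mon4_def add.commute)
  qed
  from poly_ideal_mult[OF L this, of "const_poly k"] show ?thesis
    by (simp add: m mon4_def const_poly_def right_diff_distrib mult_single)
qed

text \<open>
  Collect the monomials of \<open>f\<close> by bidegree and third degree. Modulo the quadric all monomials of one
  class agree, so a class contributes its coefficient times one monomial: the coefficient is zero for
  a class in \<open>D\<close>, and the monomial is in \<open>L\<close> for a class outside.
\<close>

lemma vanish_ideal_subset:
  assumes L: "poly_ideal L" and q: "quadric \<in> L"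
    and out: "\<And>m. (xy_deg m, zw_deg m) \<notin> D \<Longrightarrow> Poly_Mapping.single m 1 \<in> L"
  shows "vanish_ideal D \<subseteq> L"
proof
  fix f :: "'a poly4" assume f: "f \<in> vanish_ideal D"
  let ?K = "Poly_Mapping.keys f" and ?c = "poly_mapping.lookup f"
  let ?cl = "\<lambda>m. (xy_deg m, zw_deg m, xw_deg m)" and ?r = "\<lambda>(i, j, e). normal_exponent i j e"
  have "(\<Sum>m\<in>?K. Poly_Mapping.single m (?c m)) - (\<Sum>m\<in>?K. Poly_Mapping.single (?r (?cl m)) (?c m)) \<in> L"
    unfolding sum_subtractf[symmetric]
    using single_mod_quadric[OF L q] by (auto intro!: poly_ideal_sum[OF L])
  moreover have "(\<Sum>m\<in>?K. Poly_Mapping.single (?r (?cl m)) (?c m)) \<in> L"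
  proof -
    have "(\<Sum>m\<in>?K. Poly_Mapping.single (?r (?cl m)) (?c m)) =
        (\<Sum>t\<in>?cl ` ?K. \<Sum>m | m \<in> ?K \<and> ?cl m = t. Poly_Mapping.single (?r (?cl m)) (?c m))"
      by (rule sum.image_gen) simp
    also have "\<dots> \<in> L"
    proof (rule poly_ideal_sum[OF L])
      fix t assume "t \<in> ?cl ` ?K"
      then obtain m0 where t: "t = ?cl m0" and "m0 \<in> ?K" by blast
      show "(\<Sum>m | m \<in> ?K \<and> ?cl m = t. Poly_Mapping.single (?r (?cl m)) (?c m)) \<in> L"
      proof (cases "(xy_deg m0, zw_deg m0) \<in> D")
        case True
        have "(\<Sum>m | m \<in> ?K \<and> ?cl m = t. Poly_Mapping.single (?r (?cl m)) (?c m)) =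
            (\<Sum>m | m \<in> ?K \<and> ?cl m = t. const_poly (?c m) * Poly_Mapping.single (?r t) 1)"
          by (rule sum.cong) (auto simp: single_eq_const_mult[symmetric])
        also have "\<dots> = (\<Sum>m | m \<in> ?K \<and> ?cl m = t. const_poly (?c m)) * Poly_Mapping.single (?r t) 1"
          by (simp add: sum_distrib_right)
        also have "(\<Sum>m | m \<in> ?K \<and> ?cl m = t. const_poly (?c m)) =
            const_poly (\<Sum>m | m \<in> ?K \<and> ?cl m = t. ?c m)"
          by (rule const_poly_sum[symmetric])
        also have "(\<Sum>m | m \<in> ?K \<and> ?cl m = t. ?c m) = 0"
          using vanish_idealD[OF f True, of "xw_deg m0"] by (simp add: t toric_coeff_def)
        finally show ?thesis using L by (simp add: const_poly_def poly_ideal_zero)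
      next
        case False
        show ?thesis
        proof (rule poly_ideal_sum[OF L])
          fix m assume "m \<in> {m. m \<in> ?K \<and> ?cl m = t}"
          then have "(xy_deg m, zw_deg m) \<notin> D" using False by (simp add: t)
          then have "Poly_Mapping.single m (?c m) \<in> L"
            using out poly_ideal_mult[OF L] single_eq_const_mult by metis
          then show "Poly_Mapping.single (?r (?cl m)) (?c m) \<in> L"
            using poly_ideal_diff[OF L _ single_mod_quadric[OF L q, of m "?c m"]] by fastforce
        qed
      qed
    qed
    finally show ?thesis .
  qed
  ultimately have "(\<Sum>m\<in>?K. Poly_Mapping.single m (?c m)) \<in> L"
    by (rule poly_ideal_mod_mem[OF L])
  then show "f \<in> L"
    by (simp only: poly4_eq_sum_monomials[symmetric])
qed

section \<open>Membership in the ideal generated by powers and the quadric\<close>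

lemma S_ring_simps [simp]:
  "carrier S_ring = UNIV" "f \<otimes>\<^bsub>S_ring\<^esub> g = f * g" "f \<oplus>\<^bsub>S_ring\<^esub> g = f + g"
  "\<one>\<^bsub>S_ring\<^esub> = 1" "\<zero>\<^bsub>S_ring\<^esub> = 0"
  by (simp_all add: S_ring_def)

lemma cring_S_ring: "cring S_ring"
proof (rule cringI)
  show "abelian_group S_ring"
    by (rule abelian_groupI) (auto simp: add.assoc add.commute intro: left_minus exI[of _ "- _"])
  show "comm_monoid S_ring"
    by (rule comm_monoidI) (auto simp: mult.assoc mult.commute)
qed (simp add: distrib_right)

lemma ring_S_ring: "ring S_ring"
  using cring_S_ring by (rule cring.axioms)

lemma a_minus_S_ring [simp]: "\<ominus>\<^bsub>S_ring\<^esub> f = - f"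
proof -
  interpret S: cring S_ring by (rule cring_S_ring)
  have "\<ominus>\<^bsub>S_ring\<^esub> f + f = 0" using S.l_neg[of f] by simp
  then show ?thesis by (simp add: eq_neg_iff_add_eq_0)
qed

lemma ideal_S_ring_iff: "ideal L S_ring \<longleftrightarrow> poly_ideal L"
proof
  assume "ideal L S_ring"
  then interpret ideal L S_ring .
  show "poly_ideal L"
  proof (rule poly_idealI)
    show "0 \<in> L" using additive_subgroup.zero_closed[OF is_additive_subgroup] by simp
    show "f + g \<in> L" if "f \<in> L" "g \<in> L" for f g using additive_subgroup.a_closed[OF is_additive_subgroup that] by simp
    show "a * f \<in> L" if "f \<in> L" for a f using I_l_closed[OF that, of a] by simp
  qed
next
  assume L: "poly_ideal L"
  show "ideal L S_ring"
  proof (rule idealI)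
    show "subgroup L (add_monoid S_ring)"
    proof
      show "inv\<^bsub>add_monoid S_ring\<^esub> f \<in> L" if "f \<in> L" for f
        using poly_ideal_uminus[OF L that] a_minus_S_ring[of f] by (simp add: a_inv_def)
    qed (use L in \<open>auto intro: poly_ideal_zero poly_ideal_add\<close>)
  qed (use ring_S_ring poly_ideal_mult[OF L] in \<open>auto simp: mult.commute\<close>)
qed

lemma poly_ideal_genideal: "poly_ideal (Idl\<^bsub>S_ring\<^esub> A)"
  using ring.genideal_ideal[OF ring_S_ring, of A] by (simp add: ideal_S_ring_iff)

lemma genideal_subset: "poly_ideal L \<Longrightarrow> A \<subseteq> L \<Longrightarrow> Idl\<^bsub>S_ring\<^esub> A \<subseteq> L"
  using ring.genideal_minimal[OF ring_S_ring, of L A] by (simp add: ideal_S_ring_iff)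

lemma subset_genideal: "A \<subseteq> Idl\<^bsub>S_ring\<^esub> A"
  using ring.genideal_self[OF ring_S_ring, of A] by simp

lemma set_add_S_ring: "A <+>\<^bsub>S_ring\<^esub> B = {a + b | a b. a \<in> A \<and> b \<in> B}"
  by (auto simp: set_add_def set_mult_def)

lemma poly_ideal_set_add:
  assumes "poly_ideal A" "poly_ideal B"
  shows "poly_ideal (A <+>\<^bsub>S_ring\<^esub> B)"
  using ring.add_ideals[OF ring_S_ring, of A B] assms by (simp add: ideal_S_ring_iff)

lemma set_add_subset: "poly_ideal L \<Longrightarrow> A \<subseteq> L \<Longrightarrow> B \<subseteq> L \<Longrightarrow> A <+>\<^bsub>S_ring\<^esub> B \<subseteq> L"
  by (auto simp: set_add_S_ring intro: poly_ideal_add)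

lemma subset_set_add:
  assumes "poly_ideal A" "poly_ideal B"
  shows "A \<subseteq> A <+>\<^bsub>S_ring\<^esub> B" "B \<subseteq> A <+>\<^bsub>S_ring\<^esub> B"
  unfolding set_add_S_ring using poly_ideal_zero[OF assms(1)] poly_ideal_zero[OF assms(2)]
  by (force intro: exI[of _ 0])+

text \<open>
  The default simplification rules for powers rewrite to the operations of \<open>ideals_set S_ring\<close>; these two
  equations expose the product of ideals instead.
\<close>

lemma ideal_power_Suc:
  "P [^]\<^bsub>ideals_set S_ring\<^esub> Suc n = ideal_prod S_ring (P [^]\<^bsub>ideals_set S_ring\<^esub> n) P"
  by (simp add: nat_pow_def ideals_set_def)

lemma ideal_power_0: "P [^]\<^bsub>ideals_set S_ring\<^esub> (0::nat) = UNIV"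
  by (simp add: nat_pow_def ideals_set_def)

lemma poly_ideal_power:
  assumes "poly_ideal P"
  shows "poly_ideal (P [^]\<^bsub>ideals_set S_ring\<^esub> (n::nat))"
proof (induction n)
  case 0
  show ?case unfolding ideal_power_0 by (simp add: poly_ideal_def)
next
  case (Suc n)
  then show ?case
    using ring.ideal_prod_is_ideal[OF ring_S_ring] assms
    unfolding ideal_power_Suc by (simp add: ideal_S_ring_iff)
qed

lemma power_mon4_mem_ideal_power:
  assumes P: "poly_ideal P" and "mon4 a1 b1 c1 d1 \<in> P" "mon4 a2 b2 c2 d2 \<in> P"
  shows "mon4 (a1 * k + a2 * l) (b1 * k + b2 * l) (c1 * k + c2 * l) (d1 * k + d2 * l)
    \<in> P [^]\<^bsub>ideals_set S_ring\<^esub> (k + l)"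
proof (induction l)
  case 0
  have "mon4 (a1 * k) (b1 * k) (c1 * k) (d1 * k) \<in> P [^]\<^bsub>ideals_set S_ring\<^esub> k"
  proof (induction k)
    case 0
    show ?case unfolding ideal_power_0 by simp
  next
    case (Suc k)
    then show ?case
      using ideal_prod.prod[OF Suc assms(2), of S_ring]
      unfolding ideal_power_Suc by (simp add: mon4_mult add.commute)
  qed
  then show ?case by simp
next
  case (Suc l)
  then show ?case
    using ideal_prod.prod[OF Suc assms(3), of S_ring]
    unfolding add_Suc_right ideal_power_Suc by (simp add: mon4_mult algebra_simps)
qed

lemma single_mem_if_mon4_dvd:
  assumes L: "poly_ideal L" and g: "mon4 a b c d \<in> L"
    and "a \<le> poly_mapping.lookup m IX" "b \<le> poly_mapping.lookup m IY"
    "c \<le> poly_mapping.lookup m IZ" "d \<le> poly_mapping.lookup m IW"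
  shows "Poly_Mapping.single m k \<in> L"
proof -
  obtain a' b' c' d' where m: "m = expo a' b' c' d'" by (rule exponent_cases)
  have "mon4 a' b' c' d' \<in> L"
    using assms by (intro mon4_mem_ideal_mono[OF L g]) (simp_all add: m)
  from poly_ideal_mult[OF L this, of "const_poly k"] show ?thesis
    by (simp add: m mon4_def single_eq_const_mult[symmetric])
qed

lemma single_mem_if_xy_powers:
  assumes L: "poly_ideal L" and g: "\<And>a b. a + b = n \<Longrightarrow> mon4 a b 0 0 \<in> L" and m: "n \<le> xy_deg m"
  shows "Poly_Mapping.single m k \<in> L"
proof -
  define a where "a = min n (poly_mapping.lookup m IX)"
  have "a + (n - a) = n" by (simp add: a_def)
  from g[OF this] show ?thesis
    by (rule single_mem_if_mon4_dvd[OF L]) (use m in \<open>auto simp: a_def xy_deg_def\<close>)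
qed

lemma single_mem_if_zw_powers:
  assumes L: "poly_ideal L" and g: "\<And>c d. c + d = n \<Longrightarrow> mon4 0 0 c d \<in> L" and m: "n \<le> zw_deg m"
  shows "Poly_Mapping.single m k \<in> L"
proof -
  define c where "c = min n (poly_mapping.lookup m IZ)"
  have "c + (n - c) = n" by (simp add: c_def)
  from g[OF this] show ?thesis
    by (rule single_mem_if_mon4_dvd[OF L]) (use m in \<open>auto simp: c_def zw_deg_def\<close>)
qed

lemma poly_ideal_keys_ge:
  fixes w :: "(indet \<Rightarrow>\<^sub>0 nat) \<Rightarrow> nat"
  assumes "\<And>m n. w (m + n) = w m + w n"
  shows "poly_ideal {f :: 'k::field poly4. \<forall>m\<in>Poly_Mapping.keys f. n \<le> w m}"
proof (rule poly_idealI)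
  fix a f :: "'k poly4" assume f: "f \<in> {f. \<forall>m\<in>Poly_Mapping.keys f. n \<le> w m}"
  show "a * f \<in> {f. \<forall>m\<in>Poly_Mapping.keys f. n \<le> w m}"
    using keys_mult[of a f] f assms by (force intro: trans_le_add2)
qed (use keys_add in fastforce)+

text \<open>
  A weight that is at least one on all monomials of \<open>P\<close> is at least \<open>n\<close> on products of \<open>n\<close>
  factors from \<open>P\<close>.
\<close>

lemma keys_ideal_power:
  fixes w :: "(indet \<Rightarrow>\<^sub>0 nat) \<Rightarrow> nat" and P :: "'k::field poly4 set"
  assumes w: "\<And>m n. w (m + n) = w m + w n"
    and P: "P \<subseteq> {f. \<forall>m\<in>Poly_Mapping.keys f. 1 \<le> w m}"
  shows "P [^]\<^bsub>ideals_set S_ring\<^esub> n \<subseteq> {f. \<forall>m\<in>Poly_Mapping.keys f. n \<le> w m}"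
proof (induction n)
  case (Suc n)
  have "f \<in> {f. \<forall>m\<in>Poly_Mapping.keys f. Suc n \<le> w m}"
    if "f \<in> ideal_prod S_ring (P [^]\<^bsub>ideals_set S_ring\<^esub> n) P" for f
    using that
  proof (induction rule: ideal_prod.induct)
    case (prod f g)
    have "Suc n \<le> w m" if m: "m \<in> Poly_Mapping.keys (f * g)" for m
    proof -
      obtain p q where "m = p + q" "p \<in> Poly_Mapping.keys f" "q \<in> Poly_Mapping.keys g"
        using keys_mult[of f g] m by blast
      moreover from this have "n \<le> w p" "1 \<le> w q" using Suc P prod by blast+
      ultimately show ?thesis using w by simp
    qed
    then show ?case by simp
  next
    case (sum f g)
    then show ?case using poly_ideal_add[OF poly_ideal_keys_ge[OF w, of "Suc n"], of f g] by simp
  qed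
  then show ?case by (auto simp only: ideal_power_Suc)
qed simp

lemma keys_generators:
  "Idl\<^bsub>S_ring\<^esub> {indet_poly IX, indet_poly IY} \<subseteq> {f :: 'k::field poly4. \<forall>m\<in>Poly_Mapping.keys f. 1 \<le> xy_deg m}"
  "Idl\<^bsub>S_ring\<^esub> {indet_poly IZ, indet_poly IW} \<subseteq> {f :: 'k::field poly4. \<forall>m\<in>Poly_Mapping.keys f. 1 \<le> zw_deg m}"
  by (rule genideal_subset[OF poly_ideal_keys_ge];
      auto simp: grading_add indet_poly_eq_mon4 mon4_def)+

lemma poly_ideal_ideal_I: "poly_ideal (ideal_I n1 n2)"
  unfolding ideal_I_def
  by (intro poly_ideal_set_add poly_ideal_power poly_ideal_genideal)

lemma quadric_eq: "indet_poly IX * indet_poly IZ - indet_poly IY * indet_poly IW = quadric"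
  by (simp add: quadric_def indet_poly_eq_mon4 mon4_mult)

lemma ideal_I_generators:
  fixes n1 n2 :: nat
  defines "I \<equiv> ideal_I n1 n2 :: 'k::field poly4 set"
  shows "a + b = n1 \<Longrightarrow> mon4 a b 0 0 \<in> I"
    and "c + d = n2 \<Longrightarrow> mon4 0 0 c d \<in> I"
    and "quadric \<in> I"
proof -
  let ?A = "Idl\<^bsub>S_ring\<^esub> {indet_poly IX, indet_poly IY :: 'k poly4}"
  let ?B = "Idl\<^bsub>S_ring\<^esub> {indet_poly IZ, indet_poly IW :: 'k poly4}"
  let ?Q = "Idl\<^bsub>S_ring\<^esub> {quadric :: 'k poly4}"
  let ?An = "?A [^]\<^bsub>ideals_set S_ring\<^esub> n1" and ?Bn = "?B [^]\<^bsub>ideals_set S_ring\<^esub> n2"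
  have id: "poly_ideal ?A" "poly_ideal ?B" "poly_ideal ?Q" "poly_ideal ?An" "poly_ideal ?Bn"
    by (intro poly_ideal_power poly_ideal_genideal)+
  have I: "I = ?An <+>\<^bsub>S_ring\<^esub> ?Bn <+>\<^bsub>S_ring\<^esub> ?Q"
    by (simp add: I_def ideal_I_def quadric_eq)
  have sub: "?An \<subseteq> I" "?Bn \<subseteq> I" "?Q \<subseteq> I"
    unfolding I using subset_set_add[OF id(4,5)] subset_set_add[OF poly_ideal_set_add[OF id(4,5)] id(3)]
    by blast+
  have gens: "mon4 1 0 0 0 \<in> ?A" "mon4 0 1 0 0 \<in> ?A" "mon4 0 0 1 0 \<in> ?B" "mon4 0 0 0 1 \<in> ?B"
    using subset_genideal[of "{indet_poly IX, indet_poly IY :: 'k poly4}"]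
      subset_genideal[of "{indet_poly IZ, indet_poly IW :: 'k poly4}"]
    by (simp_all add: indet_poly_eq_mon4)
  show "mon4 a b 0 0 \<in> I" if "a + b = n1"
    using power_mon4_mem_ideal_power[OF id(1) gens(1,2), of a b] subsetD[OF sub(1)] that by simp
  show "mon4 0 0 c d \<in> I" if "c + d = n2"
    using power_mon4_mem_ideal_power[OF id(2) gens(3,4), of c d] subsetD[OF sub(2)] that by simp
  show "quadric \<in> I"
    using subset_genideal[of "{quadric :: 'k poly4}"] sub(3) by auto
qed

text \<open>
  The recursive powers of ideals are only used through this lemma and \<open>ideal_I_generators\<close>: together
  they say that \<open>I\<close> is generated by the monomials of the two powers and the quadric.
\<close>

lemma ideal_I_subset:
  assumes L: "poly_ideal L"
    and xy: "\<And>a b. a + b = n1 \<Longrightarrow> mon4 a b 0 0 \<in> L"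
    and zw: "\<And>c d. c + d = n2 \<Longrightarrow> mon4 0 0 c d \<in> L"
    and q: "quadric \<in> L"
  shows "ideal_I n1 n2 \<subseteq> L"
proof -
  have "f \<in> L" if "\<And>m. m \<in> Poly_Mapping.keys f \<Longrightarrow> Poly_Mapping.single m (poly_mapping.lookup f m) \<in> L" for f
  proof -
    have "(\<Sum>m\<in>Poly_Mapping.keys f. Poly_Mapping.single m (poly_mapping.lookup f m)) \<in> L"
      using that by (rule poly_ideal_sum[OF L])
    then show ?thesis by (simp only: poly4_eq_sum_monomials[symmetric])
  qed
  moreover have "Idl\<^bsub>S_ring\<^esub> {quadric} \<subseteq> L" using q by (intro genideal_subset[OF L]) simp
  ultimately show ?thesis
    unfolding ideal_I_def quadric_eq
    using keys_ideal_power[OF grading_add(1) keys_generators(1), of n1]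
      keys_ideal_power[OF grading_add(2) keys_generators(2), of n2]
      single_mem_if_xy_powers[OF L xy] single_mem_if_zw_powers[OF L zw]
    by (intro set_add_subset[OF L]) (blast dest: subsetD)+
qed

lemma ideal_I_eq_vanish: "ideal_I n1 n2 = vanish_ideal ({..<n1} \<times> {..<n2})"
proof
  show "ideal_I n1 n2 \<subseteq> vanish_ideal ({..<n1} \<times> {..<n2})"
    by (rule ideal_I_subset)
       (auto intro!: poly_ideal_vanish_ideal vanish_idealI simp: quadric_def toric_coeff_diff toric_coeff_mon4)
  show "vanish_ideal ({..<n1} \<times> {..<n2}) \<subseteq> ideal_I n1 n2"
  proof (rule vanish_ideal_subset[OF poly_ideal_ideal_I ideal_I_generators(3)])
    fix m assume "(xy_deg m, zw_deg m) \<notin> {..<n1} \<times> {..<n2}"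
    then consider "n1 \<le> xy_deg m" | "n2 \<le> zw_deg m" by force
    then show "Poly_Mapping.single m 1 \<in> ideal_I n1 n2"
      by cases (auto intro: single_mem_if_xy_powers[OF poly_ideal_ideal_I ideal_I_generators(1)]
          single_mem_if_zw_powers[OF poly_ideal_ideal_I ideal_I_generators(2)])
  qed
qed

section \<open>Vanishing of homomorphisms of negative degree\<close>

text \<open>
  For polynomials \<open>F a\<close> with coefficients \<open>c a e\<close> at \<open>u\<^sup>e\<close> the assumptions say
  \<open>F (a + 1) = u * F a\<close> and that the degrees are below \<open>N\<close>. Then \<open>F N\<close> is divisible by the power of \<open>u\<close> with
  exponent \<open>N\<close>, hence zero, and so are the others. In terms of coefficients: \<open>c a e\<close> moves up along
  the diagonal to some \<open>c N e'\<close> with \<open>e' \<ge> N\<close> if \<open>a \<le> e\<close>, and down to some \<open>c a' 0\<close> with \<open>a' > 0\<close>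
  otherwise.
\<close>

lemma chain_zero:
  fixes c :: "nat \<Rightarrow> nat \<Rightarrow> 'k::zero"
  assumes zero: "\<And>a. a < N \<Longrightarrow> c (Suc a) 0 = 0"
    and shift: "\<And>a e. a < N \<Longrightarrow> c (Suc a) (Suc e) = c a e"
    and top: "\<And>a e. a \<le> N \<Longrightarrow> N \<le> e \<Longrightarrow> c a e = 0"
    and a: "a \<le> N"
  shows "c a e = 0"
proof (cases "a \<le> e")
  case True
  have "c (a + k) (e + k) = c a e" if "a + k \<le> N" for k
    using that by (induction k) (simp_all add: shift)
  from this[of "N - a"] show ?thesis
    using top[of N "e + (N - a)"] True a by simp
next
  case False
  have "c (a - e + k) k = 0" if "a - e + k \<le> N" for k
    using that
  proof (induction k)
    case 0
    then show ?case using zero[of "a - e - 1"] False by (simp add: Suc_diff_Suc)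
  qed (simp add: shift)
  from this[of e] show ?thesis using False a by simp
qed

text \<open>
  The two alternatives for \<open>U\<close> and \<open>V\<close> are the pairs \<open>y, x\<close> and \<open>z, w\<close>; in both \<open>V\<close> acts on the binary
  forms as \<open>u\<close> and \<open>U\<close> as \<open>v = 1\<close>. They differ in the bidegree in which the relation must hold.
\<close>

lemma chain_vanish:
  assumes rel: "\<And>a. a < N \<Longrightarrow> U * p (Suc a) - V * p a \<in> vanish_ideal D"
    and UV: "U = mon4 0 1 0 0 \<and> V = mon4 1 0 0 0 \<and> (Suc i, j) \<in> D \<or>
             U = mon4 0 0 1 0 \<and> V = mon4 0 0 0 1 \<and> (i, Suc j) \<in> D"
    and N: "i + j < N" and a: "a \<le> N"
  shows "toric_coeff (p a) i j e = 0"
proof (rule chain_zero[where c = "\<lambda>a e. toric_coeff (p a) i j e", OF _ _ _ a])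
  fix a' assume a': "a' < N"
  have eq: "toric_coeff (U * p (Suc a') - V * p a') (Suc i) j e = 0" if "(Suc i, j) \<in> D" for e
    by (rule vanish_idealD[OF rel[OF a'] that])
  have eq': "toric_coeff (U * p (Suc a') - V * p a') i (Suc j) e = 0" if "(i, Suc j) \<in> D" for e
    by (rule vanish_idealD[OF rel[OF a'] that])
  show "toric_coeff (p (Suc a')) i j 0 = 0"
    using UV eq[of 0] eq'[of 0] by (auto simp: toric_coeff_diff toric_coeff_mon4_mult)
  show "toric_coeff (p (Suc a')) i j (Suc e) = toric_coeff (p a') i j e" for e
    using UV eq[of "Suc e"] eq'[of "Suc e"] by (auto simp: toric_coeff_diff toric_coeff_mon4_mult)
next
  show "toric_coeff (p a) i j e = 0" if "N \<le> e" for a e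
    using N that by (intro toric_coeff_large) simp
qed

text \<open>
  The map \<open>f \<mapsto> \<psi> f + J\<close> is a homomorphism \<open>J \<rightarrow> S/J\<close> of degree \<open>d\<close>.
\<close>

definition hom_lift :: "'k::field poly4 set \<Rightarrow> int \<Rightarrow> ('k poly4 \<Rightarrow> 'k poly4) \<Rightarrow> bool" where
  "hom_lift J d \<psi> \<longleftrightarrow>
     (\<forall>f\<in>J. \<forall>g\<in>J. \<psi> (f + g) - (\<psi> f + \<psi> g) \<in> J) \<and>
     (\<forall>a. \<forall>f\<in>J. \<psi> (a * f) - a * \<psi> f \<in> J) \<and>
     (\<forall>e. \<forall>f\<in>J \<inter> deg_part e. \<exists>g\<in>deg_part (e + d). \<psi> f - g \<in> J)"

lemma hom_lift_add: "hom_lift J d \<psi> \<Longrightarrow> f \<in> J \<Longrightarrow> g \<in> J \<Longrightarrow> \<psi> (f + g) - (\<psi> f + \<psi> g) \<in> J"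
  and hom_lift_mult: "hom_lift J d \<psi> \<Longrightarrow> f \<in> J \<Longrightarrow> \<psi> (a * f) - a * \<psi> f \<in> J"
  by (simp_all add: hom_lift_def)

lemma hom_lift_deg:
  assumes "hom_lift J d \<psi>" "f \<in> J" "f \<in> deg_part e"
  obtains g where "g \<in> deg_part (e + d)" "\<psi> f - g \<in> J"
  using assms unfolding hom_lift_def by blast

lemma mon4_deg_part: "mon4 a b c d \<in> deg_part (int (a + b + c + d))"
  by (auto simp: deg_part_eq mon4_def)

lemma quadric_deg_part: "quadric \<in> deg_part 2"
proof -
  have "Poly_Mapping.keys quadric \<subseteq> {expo 1 0 1 0, expo 0 1 0 1}"
    unfolding quadric_def mon4_def using keys_diff by fastforce
  then show ?thesis by (auto simp: deg_part_eq)
qed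

lemma bideg_part_deg_part: "f \<in> bideg_part i j \<Longrightarrow> f \<in> deg_part (int (i + j))"
  by (auto simp: bideg_part_def deg_part_eq xy_deg_def zw_deg_def)

lemma bideg_component:
  "\<exists>g\<in>bideg_part i j. \<forall>e. toric_coeff (f - g) i j e = 0"
proof (induction f rule: poly4_induct)
  case (monomial m c)
  show ?case
  proof (cases "xy_deg m = i \<and> zw_deg m = j")
    case True
    then show ?thesis
      by (intro bexI[of _ "Poly_Mapping.single m c"]) (auto simp: bideg_part_def xy_deg_def zw_deg_def split: if_splits)
  next
    case False
    then show ?thesis
      by (intro bexI[of _ 0]) (auto simp: toric_coeff_single bideg_part_def)
  qed
next
  case (add f g)
  then obtain f' g' where *: "f' \<in> bideg_part i j" "g' \<in> bideg_part i j"
    "\<forall>e. toric_coeff (f - f') i j e = 0" "\<forall>e. toric_coeff (g - g') i j e = 0" by blast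
  show ?case
  proof
    show "f' + g' \<in> bideg_part i j"
      using * keys_add[of f' g'] by (auto simp: bideg_part_def)
    have "f + g - (f' + g') = (f - f') + (g - g')" by simp
    then show "\<forall>e. toric_coeff (f + g - (f' + g')) i j e = 0" using * by (simp only: toric_coeff_add) simp
  qed
qed

text \<open>
  A homomorphism carries a syzygy of elements of \<open>J\<close> to a relation modulo \<open>J\<close> between any
  representatives of their images. Three terms cover all syzygies used for \<open>I\<close>.
\<close>

lemma hom_lift_syzygy:
  assumes J: "poly_ideal J" and \<psi>: "hom_lift J d \<psi>"
    and mem: "f \<in> J" "g \<in> J" "h \<in> J" and syz: "a * f = b * g + c * h"
    and f': "\<psi> f - f' \<in> J" and g': "\<psi> g - g' \<in> J" and h': "\<psi> h - h' \<in> J"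
  shows "a * f' - (b * g' + c * h') \<in> J"
proof -
  have mul: "\<psi> (a * f) - a * f' \<in> J" if "f \<in> J" "\<psi> f - f' \<in> J" for a f f'
    using poly_ideal_add[OF J hom_lift_mult[OF \<psi> that(1), of a] poly_ideal_mult[OF J that(2), of a]]
    by (simp add: algebra_simps)
  have "\<psi> (b * g + c * h) - (\<psi> (b * g) + \<psi> (c * h)) \<in> J"
    by (intro hom_lift_add[OF \<psi>] poly_ideal_mult[OF J] mem)
  from poly_ideal_add[OF J this poly_ideal_add[OF J mul[OF mem(2) g', of b] mul[OF mem(3) h', of c]]]
  have "\<psi> (a * f) - (b * g' + c * h') \<in> J" by (simp add: syz algebra_simps)
  from poly_ideal_diff[OF J this mul[OF mem(1) f', of a]] show ?thesis by (simp add: algebra_simps)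
qed

lemma hom_lift_syzygy2:
  assumes "poly_ideal J" "hom_lift J d \<psi>" "f \<in> J" "g \<in> J" "a * f = b * g"
    and "\<psi> f - f' \<in> J" "\<psi> g - g' \<in> J"
  shows "a * f' - b * g' \<in> J"
  using hom_lift_syzygy[of J d \<psi> f g 0 a b 0 f' g' "\<psi> 0"] assms poly_ideal_zero[of J] by simp

text \<open>
  The bidegrees in which every element of \<open>J'\<close> must vanish: those of \<open>A\<close> apart from its socle.
\<close>

definition off_corner :: "nat \<Rightarrow> nat \<Rightarrow> (nat \<times> nat) set" where
  "off_corner n1 n2 = {..<n1} \<times> {..<n2} - {(n1 - 1, n2 - 1)}"

lemma poly_ideal_off_corner: "poly_ideal (vanish_ideal (off_corner n1 n2))"
  by (rule poly_ideal_vanish_ideal) (auto simp: off_corner_def)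

text \<open>
  What the argument uses of \<open>J'\<close>. The last assumption is the inclusion of the socle of \<open>S/J\<close> in the corner
  bidegree, in terms of representatives.
\<close>

locale corner_ideal =
  fixes n1 n2 :: nat and J :: "'k::field poly4 set"
  assumes n1: "3 \<le> n1" and n2: "3 \<le> n2"
    and J: "poly_ideal J"
    and I_le: "ideal_I n1 n2 \<subseteq> J"
    and J_le: "J \<subseteq> vanish_ideal (off_corner n1 n2)"
    and socle: "\<And>g. (\<And>v. indet_poly v * g \<in> J) \<Longrightarrow> \<exists>h\<in>bideg_part (n1 - 1) (n2 - 1). g - h \<in> J"
begin

lemma memI: "(\<And>i j e. i < n1 \<Longrightarrow> j < n2 \<Longrightarrow> toric_coeff f i j e = 0) \<Longrightarrow> f \<in> J"
  by (rule subsetD[OF I_le]) (auto simp: ideal_I_eq_vanish intro: vanish_idealI)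

lemma memD: "f \<in> J \<Longrightarrow> (i, j) \<in> off_corner n1 n2 \<Longrightarrow> toric_coeff f i j e = 0"
  using J_le by (blast intro: vanish_idealD)

lemma generators:
  "a + b = n1 \<Longrightarrow> mon4 a b 0 0 \<in> J" "c + d = n2 \<Longrightarrow> mon4 0 0 c d \<in> J" "quadric \<in> J"
  using ideal_I_generators[where ?'k = 'k, THEN subsetD[OF I_le]] by simp_all

text \<open>
  In bidegree \<open>(i, j)\<close> with \<open>i + 1 < n1\<close> the syzygies between neighbouring monomials give the chain of
  relations with multipliers \<open>y, x\<close>. For \<open>i = n1 - 1\<close> they carry no information, as \<open>x\<close> and \<open>y\<close> leave the
  box. For degree reasons this case occurs for \<open>d = - 1\<close> and \<open>j = 0\<close> only, and there the
  syzygies with the quadric give the chain with multipliers \<open>z, w\<close>.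
\<close>

lemma hom_lift_xy_powers:
  assumes \<psi>: "hom_lift J d \<psi>" and d: "d < 0" and q: "d = - 1 \<Longrightarrow> \<psi> quadric \<in> J" and a: "a \<le> n1"
  shows "\<psi> (mon4 a (n1 - a) 0 0) \<in> J"
proof -
  have "\<exists>g. g \<in> deg_part (int n1 + d) \<and> \<psi> (mon4 a (n1 - a) 0 0) - g \<in> J" if "a \<le> n1" for a
  proof -
    have m: "mon4 a (n1 - a) 0 0 \<in> J" using that by (intro generators) simp
    have "mon4 a (n1 - a) 0 0 \<in> deg_part (int n1)" using mon4_deg_part[of a "n1 - a" 0 0] that by simp
    then show ?thesis by (rule hom_lift_deg[OF \<psi> m]) blast
  qed
  then obtain p where p: "\<And>a. a \<le> n1 \<Longrightarrow> p a \<in> deg_part (int n1 + d)"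
    "\<And>a. a \<le> n1 \<Longrightarrow> \<psi> (mon4 a (n1 - a) 0 0) - p a \<in> J" by metis
  have YX: "mon4 0 1 0 0 * p (Suc a) - mon4 1 0 0 0 * p a \<in> J" if "a < n1" for a
    by (rule hom_lift_syzygy2[OF J \<psi> generators(1) generators(1) _ p(2) p(2)])
       (use that in \<open>simp_all add: mon4_mult Suc_diff_Suc\<close>)
  have ZW: "mon4 0 0 1 0 * p (Suc a) - mon4 0 0 0 1 * p a \<in> J" if "a < n1" "d = - 1" for a
  proof -
    have "\<psi> quadric - 0 \<in> J" using q that by simp
    then have "mon4 0 0 1 0 * p (Suc a) - (mon4 0 0 0 1 * p a + mon4 a (n1 - Suc a) 0 0 * 0) \<in> J"
      by (rule hom_lift_syzygy[OF J \<psi> generators(1) generators(1) generators(3) _ p(2) p(2), rotated -1])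
         (use that in \<open>simp_all add: mon4_mult Suc_diff_Suc quadric_def right_diff_distrib\<close>)
    then show ?thesis by simp
  qed
  have "p a \<in> J"
  proof (rule memI)
    fix i j e assume i: "i < n1" and j: "j < n2"
    consider "int (i + j) \<noteq> int n1 + d" | "int (i + j) = int n1 + d" "Suc i < n1"
      | "int (i + j) = int n1 + d" "Suc i = n1" using i by linarith
    then show "toric_coeff (p a) i j e = 0"
    proof cases
      case 1
      then show ?thesis using toric_coeff_deg_part[OF p(1)[OF a]] by blast
    next
      case 2
      then show ?thesis using d j n1 n2
        by (intro chain_vanish[where p = p, OF subsetD[OF J_le YX] _ _ a]) (auto simp: off_corner_def)
    next
      case 3
      then have d1: "d = - 1" and "j = 0" using d by linarith+
      then show ?thesis using 3 n1 n2
        by (intro chain_vanish[where p = p, OF subsetD[OF J_le ZW[OF _ d1]] _ _ a]) (auto simp: off_corner_def)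
    qed
  qed
  then show ?thesis using poly_ideal_mod_mem[OF J p(2)[OF a]] by simp
qed

text \<open>
  The mirror image of \<open>hom_lift_xy_powers\<close> under exchanging \<open>x, w\<close> and \<open>y, z\<close>, which maps the quadric to
  its negative.
\<close>

lemma hom_lift_zw_powers:
  assumes \<psi>: "hom_lift J d \<psi>" and d: "d < 0" and q: "d = - 1 \<Longrightarrow> \<psi> quadric \<in> J" and a: "a \<le> n2"
  shows "\<psi> (mon4 0 0 (n2 - a) a) \<in> J"
proof -
  have "\<exists>g. g \<in> deg_part (int n2 + d) \<and> \<psi> (mon4 0 0 (n2 - a) a) - g \<in> J" if "a \<le> n2" for a
  proof -
    have m: "mon4 0 0 (n2 - a) a \<in> J" using that by (intro generators) simp
    have "mon4 0 0 (n2 - a) a \<in> deg_part (int n2)" using mon4_deg_part[of 0 0 "n2 - a" a] that by simp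
    then show ?thesis by (rule hom_lift_deg[OF \<psi> m]) blast
  qed
  then obtain p where p: "\<And>a. a \<le> n2 \<Longrightarrow> p a \<in> deg_part (int n2 + d)"
    "\<And>a. a \<le> n2 \<Longrightarrow> \<psi> (mon4 0 0 (n2 - a) a) - p a \<in> J" by metis
  have ZW: "mon4 0 0 1 0 * p (Suc a) - mon4 0 0 0 1 * p a \<in> J" if "a < n2" for a
    by (rule hom_lift_syzygy2[OF J \<psi> generators(2) generators(2) _ p(2) p(2)])
       (use that in \<open>simp_all add: mon4_mult Suc_diff_Suc\<close>)
  have YX: "mon4 0 1 0 0 * p (Suc a) - mon4 1 0 0 0 * p a \<in> J" if "a < n2" "d = - 1" for a
  proof -
    have "\<psi> quadric - 0 \<in> J" using q that by simp
    then have "mon4 0 1 0 0 * p (Suc a) - (mon4 1 0 0 0 * p a + - mon4 0 0 (n2 - Suc a) a * 0) \<in> J"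
      by (rule hom_lift_syzygy[OF J \<psi> generators(2) generators(2) generators(3) _ p(2) p(2), rotated -1])
         (use that in \<open>simp_all add: mon4_mult Suc_diff_Suc quadric_def right_diff_distrib\<close>)
    then show ?thesis by simp
  qed
  have "p a \<in> J"
  proof (rule memI)
    fix i j e assume i: "i < n1" and j: "j < n2"
    consider "int (i + j) \<noteq> int n2 + d" | "int (i + j) = int n2 + d" "Suc j < n2"
      | "int (i + j) = int n2 + d" "Suc j = n2" using j by linarith
    then show "toric_coeff (p a) i j e = 0"
    proof cases
      case 1
      then show ?thesis using toric_coeff_deg_part[OF p(1)[OF a]] by blast
    next
      case 2
      then show ?thesis using d i n1 n2
        by (intro chain_vanish[where p = p, OF subsetD[OF J_le ZW] _ _ a]) (auto simp: off_corner_def)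
    next
      case 3
      then have d1: "d = - 1" and "i = 0" using d by linarith+
      then show ?thesis using 3 n1 n2
        by (intro chain_vanish[where p = p, OF subsetD[OF J_le YX[OF _ d1]] _ _ a]) (auto simp: off_corner_def)
    qed
  qed
  then show ?thesis using poly_ideal_mod_mem[OF J p(2)[OF a]] by simp
qed

text \<open>
  For \<open>d < - 2\<close> the image of the quadric has negative degree, and for \<open>d = - 2\<close> it is a constant \<open>h\<close>.
  In the syzygy \<open>z \<cdot> x^n1 = w \<cdot> x^(n1 - 1) y + x^(n1 - 1) \<cdot> (xz - yw)\<close> the two monomials of degree \<open>n1\<close>
  have image zero already, so it shows that \<open>x^(n1 - 1)\<close> kills \<open>h\<close>; but that power is nonzero modulo \<open>J\<close>.
\<close>

lemma hom_lift_quadric: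
  assumes \<psi>: "hom_lift J d \<psi>" and d: "d < - 1"
  shows "\<psi> quadric \<in> J"
proof -
  obtain h where h: "h \<in> deg_part (2 + d)" "\<psi> quadric - h \<in> J"
    by (rule hom_lift_deg[OF \<psi> generators(3) quadric_deg_part])
  have x: "\<psi> (mon4 a (n1 - a) 0 0) - 0 \<in> J" if "a \<le> n1" for a
    using hom_lift_xy_powers[OF \<psi> _ _ that] d by simp
  have "mon4 0 0 1 0 * 0 - (mon4 0 0 0 1 * 0 + mon4 (n1 - 1) 0 0 0 * h) \<in> J"
    by (rule hom_lift_syzygy[OF J \<psi> generators(1) generators(1) generators(3) _ x x h(2), of n1 "n1 - 1"])
       (use n1 in \<open>simp_all add: mon4_mult quadric_def right_diff_distrib\<close>)
  then have xh: "mon4 (n1 - 1) 0 0 0 * h \<in> J"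
    using poly_ideal_uminus[OF J] by fastforce
  have "h \<in> J"
  proof (rule memI)
    fix i j e
    show "toric_coeff h i j e = 0"
    proof (cases "i = 0 \<and> j = 0 \<and> e = 0")
      case True
      then show ?thesis
        using memD[OF xh, of "n1 - 1" 0 "n1 - 1"] n1 n2 by (simp add: toric_coeff_mon4_mult off_corner_def)
    next
      case False
      then have "int (i + j) \<noteq> 2 + d \<or> i + j < e" using d by linarith
      then show ?thesis
        using toric_coeff_deg_part[OF h(1), of i j e] toric_coeff_large[of i j e h] by blast
    qed
  qed
  then show ?thesis using poly_ideal_mod_mem[OF J h(2)] by simp
qed

text \<open>
  A variable raises the bidegree, so the corner component leaves the box.
\<close>

lemma indet_mult_off_corner:
  assumes "f \<in> vanish_ideal (off_corner n1 n2)"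
  shows "indet_poly v * f \<in> ideal_I n1 n2"
  unfolding ideal_I_eq_vanish
proof (rule vanish_idealI, clarsimp)
  fix i j e assume ij: "i < n1" "j < n2"
  have "toric_coeff f (i - 1) j e = 0" if "1 \<le> i" for e
    by (rule vanish_idealD[OF assms]) (use ij that in \<open>auto simp: off_corner_def\<close>)
  moreover have "toric_coeff f i (j - 1) e = 0" if "1 \<le> j" for e
    by (rule vanish_idealD[OF assms]) (use ij that in \<open>auto simp: off_corner_def\<close>)
  ultimately show "toric_coeff (indet_poly v * f) i j e = 0"
    by (cases v) (simp_all add: indet_poly_eq_mon4 toric_coeff_mon4_mult)
qed

text \<open>
  By the preceding lemmas \<open>\<psi>\<close> kills the generators of \<open>I\<close>, hence \<open>I\<close>. An arbitrary \<open>f\<close> may therefore be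
  replaced by its corner component \<open>f'\<close>. The variables map \<open>f'\<close> into \<open>I\<close>, so \<open>\<psi> f'\<close> is in the socle,
  that is, in the corner bidegree; but its total degree is smaller by \<open>- d\<close>.
\<close>

lemma negative_hom_lift_zero:
  assumes \<psi>: "hom_lift J d \<psi>" and d: "d < 0" and q: "d = - 1 \<Longrightarrow> \<psi> quadric \<in> J" and f: "f \<in> J"
  shows "\<psi> f \<in> J"
proof -
  have \<psi>0: "\<psi> 0 \<in> J" using hom_lift_mult[OF \<psi> poly_ideal_zero[OF J], of 0] by simp
  have K: "poly_ideal {f \<in> J. \<psi> f \<in> J}"
  proof (rule poly_idealI)
    show "f + g \<in> {f \<in> J. \<psi> f \<in> J}" if "f \<in> {f \<in> J. \<psi> f \<in> J}" "g \<in> {f \<in> J. \<psi> f \<in> J}" for f g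
      using that hom_lift_add[OF \<psi>, of f g] poly_ideal_mod_mem[OF J] poly_ideal_add[OF J] by blast
    show "a * f \<in> {f \<in> J. \<psi> f \<in> J}" if "f \<in> {f \<in> J. \<psi> f \<in> J}" for a f
      using that hom_lift_mult[OF \<psi>, of f a] poly_ideal_mod_mem[OF J] poly_ideal_mult[OF J] by blast
  qed (use \<psi>0 poly_ideal_zero[OF J] in simp)
  have "ideal_I n1 n2 \<subseteq> {f \<in> J. \<psi> f \<in> J}"
  proof (rule ideal_I_subset[OF K])
    show "mon4 a b 0 0 \<in> {f \<in> J. \<psi> f \<in> J}" if "a + b = n1" for a b
      using hom_lift_xy_powers[OF \<psi> d q, of a] generators(1) that by auto
    show "mon4 0 0 a b \<in> {f \<in> J. \<psi> f \<in> J}" if "a + b = n2" for a b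
      using hom_lift_zw_powers[OF \<psi> d q, of b] generators(2) that by auto
    show "quadric \<in> {f \<in> J. \<psi> f \<in> J}"
      using hom_lift_quadric[OF \<psi>] q d generators(3) by (cases "d = - 1") auto
  qed
  then have \<psi>I: "\<psi> f \<in> J" if "f \<in> ideal_I n1 n2" for f using that by blast
  obtain f' where f': "f' \<in> bideg_part (n1 - 1) (n2 - 1)" "\<And>e. toric_coeff (f - f') (n1 - 1) (n2 - 1) e = 0"
    using bideg_component by blast
  have diff: "f - f' \<in> ideal_I n1 n2"
    unfolding ideal_I_eq_vanish
  proof (rule vanish_idealI, clarsimp)
    fix i j e assume "i < n1" "j < n2"
    then show "toric_coeff (f - f') i j e = 0"
      using f'(2) memD[OF f, of i j] toric_coeff_bideg_part[OF f'(1), of i j]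
      by (cases "(i, j) = (n1 - 1, n2 - 1)") (auto simp: toric_coeff_diff off_corner_def)
  qed
  have f'J: "f' \<in> J"
    using poly_ideal_diff[OF J f subsetD[OF I_le diff]] by simp
  \<comment> \<open>Two representatives of the image: one of the degree forced by homogeneity, and below one in the corner.\<close>
  obtain g where g: "g \<in> deg_part (int (n1 - 1 + (n2 - 1)) + d)" "\<psi> f' - g \<in> J"
    by (rule hom_lift_deg[OF \<psi> f'J bideg_part_deg_part[OF f'(1)]])
  have "indet_poly v * \<psi> f' \<in> J" for v
    using poly_ideal_mod_sym[OF J hom_lift_mult[OF \<psi> f'J, of "indet_poly v"]]
      \<psi>I[OF indet_mult_off_corner[OF subsetD[OF J_le f'J]]]
    by (rule poly_ideal_mod_mem[OF J])
  from socle[OF this] obtain h where h: "h \<in> bideg_part (n1 - 1) (n2 - 1)" "\<psi> f' - h \<in> J" by blast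
  have gh: "g - h \<in> J"
    using poly_ideal_mod_trans[OF J poly_ideal_mod_sym[OF J g(2)] h(2)] .
  have "g \<in> J"
  proof (rule memI)
    fix i j e assume "i < n1" "j < n2"
    then show "toric_coeff g i j e = 0"
      using toric_coeff_deg_part[OF g(1), of i j e] memD[OF gh, of i j e] toric_coeff_bideg_part[OF h(1), of i j e] d
      by (cases "(i, j) = (n1 - 1, n2 - 1)") (auto simp: toric_coeff_diff off_corner_def)
  qed
  then have "\<psi> f' \<in> J" using poly_ideal_mod_mem[OF J g(2)] by blast
  then have "\<psi> (f - f') + \<psi> f' \<in> J" using \<psi>I[OF diff] poly_ideal_add[OF J] by blast
  with hom_lift_add[OF \<psi> subsetD[OF I_le diff] f'J] show ?thesis
    using poly_ideal_mod_mem[OF J] by fastforce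
qed

end

section \<open>Derivations with constant coefficients\<close>

definition partial_deriv :: "indet \<Rightarrow> 'k::field poly4 \<Rightarrow> 'k poly4" where
  "partial_deriv v f = (\<Sum>m\<in>Poly_Mapping.keys f. Poly_Mapping.single (m - Poly_Mapping.single v 1)
     (of_nat (poly_mapping.lookup m v) * poly_mapping.lookup f m))"

lemma partial_deriv_eq_sum:
  assumes "finite A" "Poly_Mapping.keys f \<subseteq> A"
  shows "partial_deriv v f = (\<Sum>m\<in>A. Poly_Mapping.single (m - Poly_Mapping.single v 1)
     (of_nat (poly_mapping.lookup m v) * poly_mapping.lookup f m))"
  unfolding partial_deriv_def
  by (rule sum.mono_neutral_left) (use assms in \<open>auto simp: in_keys_iff\<close>)

lemma partial_deriv_add: "partial_deriv v (f + g) = partial_deriv v f + partial_deriv v g"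
proof -
  let ?A = "Poly_Mapping.keys f \<union> Poly_Mapping.keys g"
  have "Poly_Mapping.keys (f + g) \<subseteq> ?A" by (rule keys_add)
  then show ?thesis
    using partial_deriv_eq_sum[of ?A "f + g" v] partial_deriv_eq_sum[of ?A f v] partial_deriv_eq_sum[of ?A g v]
    by (simp add: lookup_add distrib_left single_add sum.distrib)
qed

lemma partial_deriv_single: "partial_deriv v (Poly_Mapping.single m c) =
    Poly_Mapping.single (m - Poly_Mapping.single v 1) (of_nat (poly_mapping.lookup m v) * c)"
  using partial_deriv_eq_sum[of "{m}" "Poly_Mapping.single m c" v] by simp

lemma exponent_diff_single:
  assumes "poly_mapping.lookup m v \<noteq> (0::nat)"
  shows "(m - Poly_Mapping.single v 1) + Poly_Mapping.single v 1 = m"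
  by (rule poly_mapping_eqI) (use assms in \<open>auto simp: lookup_add lookup_minus lookup_single when_def\<close>)

text \<open>
  Both sides are bilinear, which reduces the product rule to monomials. There the only subtlety is the
  truncated subtraction of exponents (fact \<open>left\<close>): it goes wrong only when its coefficient is zero.
\<close>

lemma partial_deriv_mult: "partial_deriv v (f * g) = f * partial_deriv v g + g * partial_deriv v f"
proof (induction f rule: poly4_induct)
  case (monomial m c)
  show ?case
  proof (induction g rule: poly4_induct)
    case (monomial n c')
    let ?e = "Poly_Mapping.single v (1::nat)"
    have left: "Poly_Mapping.single (m + n - ?e) (of_nat (poly_mapping.lookup n v) * k) =
        Poly_Mapping.single (m + (n - ?e)) (of_nat (poly_mapping.lookup n v) * k)" for k :: 'a and m n
    proof (cases "poly_mapping.lookup n v = 0")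
      case False
      then have "m + n - ?e = m + (n - ?e)"
        using exponent_diff_single[OF False] by (metis add.assoc add_diff_cancel_right')
      then show ?thesis by simp
    qed simp
    show ?case
      using left[of m n "c * c'"] left[of n m "c * c'"]
      by (simp add: mult_single partial_deriv_single lookup_add distrib_right single_add algebra_simps)
  next
    case (add f g)
    then show ?case by (simp add: distrib_left distrib_right partial_deriv_add algebra_simps)
  qed
next
  case (add f g)
  then show ?case by (simp add: distrib_left distrib_right partial_deriv_add algebra_simps)
qed

lemma partial_deriv_const_poly [simp]: "partial_deriv v (const_poly c) = 0"
  by (simp add: const_poly_def partial_deriv_single)

lemma deg_part_add: "f \<in> deg_part e \<Longrightarrow> g \<in> deg_part e \<Longrightarrow> f + g \<in> deg_part e"
  using keys_add[of f g] by (auto simp: deg_part_eq)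

lemma zero_deg_part: "0 \<in> deg_part e"
  by (simp add: deg_part_eq)

lemma deg_part_const_mult:
  assumes "f \<in> deg_part e"
  shows "const_poly c * f \<in> deg_part e"
  using assms keys_mult[of "const_poly c" f] by (fastforce simp: deg_part_eq const_poly_def split: if_splits)

lemma deg_part_sum: "(\<And>i. i \<in> A \<Longrightarrow> h i \<in> deg_part e) \<Longrightarrow> sum h A \<in> deg_part e"
  by (induction A rule: infinite_finite_induct) (auto intro: zero_deg_part deg_part_add)

lemma partial_deriv_deg_part:
  assumes "f \<in> deg_part e"
  shows "partial_deriv v f \<in> deg_part (e - 1)"
  unfolding partial_deriv_def
proof (rule deg_part_sum)
  fix m assume m: "m \<in> Poly_Mapping.keys f"
  show "Poly_Mapping.single (m - Poly_Mapping.single v 1)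
      (of_nat (poly_mapping.lookup m v) * poly_mapping.lookup f m) \<in> deg_part (e - 1)"
  proof (cases "poly_mapping.lookup m v = 0")
    case True
    then show ?thesis by (simp add: zero_deg_part)
  next
    case False
    have "int (xy_deg (m - Poly_Mapping.single v 1) + zw_deg (m - Poly_Mapping.single v 1))
        + int (xy_deg (Poly_Mapping.single v 1) + zw_deg (Poly_Mapping.single v 1)) = int (xy_deg m + zw_deg m)"
      using grading_add(1,2)[of "m - Poly_Mapping.single v 1" "Poly_Mapping.single v 1"]
      unfolding exponent_diff_single[OF False] by simp
    moreover have "xy_deg (Poly_Mapping.single v 1) + zw_deg (Poly_Mapping.single v 1) = 1"
      by (cases v) (simp_all add: grading_defs lookup_single)
    moreover have "int (xy_deg m + zw_deg m) = e" using assms m by (simp add: deg_part_eq)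
    ultimately show ?thesis by (auto simp: deg_part_eq)
  qed
qed

definition directional_derivative ::
    "'k::field \<Rightarrow> 'k \<Rightarrow> 'k \<Rightarrow> 'k \<Rightarrow> 'k poly4 \<Rightarrow> 'k poly4" where
  "directional_derivative \<alpha> \<beta> \<gamma> \<delta> f = const_poly \<alpha> * partial_deriv IX f + const_poly \<beta> * partial_deriv IY f
     + const_poly \<gamma> * partial_deriv IZ f + const_poly \<delta> * partial_deriv IW f"

lemma directional_derivative_add:
  "directional_derivative \<alpha> \<beta> \<gamma> \<delta> (f + g) =
   directional_derivative \<alpha> \<beta> \<gamma> \<delta> f + directional_derivative \<alpha> \<beta> \<gamma> \<delta> g"
  by (simp add: directional_derivative_def partial_deriv_add algebra_simps)

lemma directional_derivative_mult:
  "directional_derivative \<alpha> \<beta> \<gamma> \<delta> (f * g) =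
   f * directional_derivative \<alpha> \<beta> \<gamma> \<delta> g + g * directional_derivative \<alpha> \<beta> \<gamma> \<delta> f"
  by (simp add: directional_derivative_def partial_deriv_mult algebra_simps)

lemma directional_derivative_const: "directional_derivative \<alpha> \<beta> \<gamma> \<delta> (const_poly c) = 0"
  by (simp add: directional_derivative_def)

lemma directional_derivative_deg_part:
  "f \<in> deg_part e \<Longrightarrow> directional_derivative \<alpha> \<beta> \<gamma> \<delta> f \<in> deg_part (e - 1)"
  unfolding directional_derivative_def
  by (intro deg_part_add deg_part_const_mult partial_deriv_deg_part)

lemma exponent_deg_1:
  assumes "xy_deg m + zw_deg m = 1"
  shows "m \<in> {expo 1 0 0 0, expo 0 1 0 0, expo 0 0 1 0, expo 0 0 0 1}"
proof -
  obtain a b c d where m: "m = expo a b c d" by (rule exponent_cases)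
  then have "a + b + c + d = 1" using assms by simp
  then consider "a = 1" "b = 0" "c = 0" "d = 0" | "a = 0" "b = 1" "c = 0" "d = 0"
    | "a = 0" "b = 0" "c = 1" "d = 0" | "a = 0" "b = 0" "c = 0" "d = 1" by linarith
  then show ?thesis by cases (simp_all add: m)
qed

lemma expo_eq_iff: "expo a b c d = expo a' b' c' d' \<longleftrightarrow> a = a' \<and> b = b' \<and> c = c' \<and> d = d'"
  by (metis lookup_expo)

lemma partial_deriv_mon4:
  "partial_deriv v (mon4 1 0 1 0) = (case v of IX \<Rightarrow> mon4 0 0 1 0 | IZ \<Rightarrow> mon4 1 0 0 0 | _ \<Rightarrow> 0)"
  "partial_deriv v (mon4 0 1 0 1) = (case v of IY \<Rightarrow> mon4 0 0 0 1 | IW \<Rightarrow> mon4 0 1 0 0 | _ \<Rightarrow> 0)"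
proof -
  have "expo 1 0 1 0 - Poly_Mapping.single IX 1 = expo 0 0 1 0"
    "expo 1 0 1 0 - Poly_Mapping.single IZ 1 = expo 1 0 0 0"
    "expo 0 1 0 1 - Poly_Mapping.single IY 1 = expo 0 0 0 1"
    "expo 0 1 0 1 - Poly_Mapping.single IW 1 = expo 0 1 0 0"
    by (rule exponent_eqI; simp add: lookup_minus lookup_single)+
  then show "partial_deriv v (mon4 1 0 1 0) = (case v of IX \<Rightarrow> mon4 0 0 1 0 | IZ \<Rightarrow> mon4 1 0 0 0 | _ \<Rightarrow> 0)"
    "partial_deriv v (mon4 0 1 0 1) = (case v of IY \<Rightarrow> mon4 0 0 0 1 | IW \<Rightarrow> mon4 0 1 0 0 | _ \<Rightarrow> 0)"
    by (cases v; simp add: mon4_def partial_deriv_single)+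
qed

text \<open>
  The quadratic form \<open>xz - yw\<close> is nondegenerate: its partial derivatives \<open>z, - w, x, - y\<close> span the linear
  forms.
\<close>

lemma linear_form_eq_derivative_quadric:
  assumes h: "h \<in> deg_part 1"
  obtains \<alpha> \<beta> \<gamma> \<delta> where "h = directional_derivative \<alpha> \<beta> \<gamma> \<delta> quadric"
proof
  let ?l = "\<lambda>a b c d. poly_mapping.lookup h (expo a b c d)"
  have pdq: "partial_deriv IX quadric = (mon4 0 0 1 0 :: 'a poly4)" "partial_deriv IY quadric = - (mon4 0 0 0 1 :: 'a poly4)"
    "partial_deriv IZ quadric = (mon4 1 0 0 0 :: 'a poly4)" "partial_deriv IW quadric = - (mon4 0 1 0 0 :: 'a poly4)"
  proof -
    have partial_deriv_q: "partial_deriv v (quadric :: 'a poly4) = partial_deriv v (mon4 1 0 1 0) - partial_deriv v (mon4 0 1 0 1)" for v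
      using partial_deriv_add[of v "quadric :: 'a poly4" "mon4 0 1 0 1"] by (simp add: quadric_def)
    show "partial_deriv IX quadric = (mon4 0 0 1 0 :: 'a poly4)" "partial_deriv IY quadric = - (mon4 0 0 0 1 :: 'a poly4)"
      "partial_deriv IZ quadric = (mon4 1 0 0 0 :: 'a poly4)" "partial_deriv IW quadric = - (mon4 0 1 0 0 :: 'a poly4)"
      unfolding partial_deriv_q partial_deriv_mon4 by simp_all
  qed
  have "h = Poly_Mapping.single (expo 1 0 0 0) (?l 1 0 0 0) + Poly_Mapping.single (expo 0 1 0 0) (?l 0 1 0 0)
    + Poly_Mapping.single (expo 0 0 1 0) (?l 0 0 1 0) + Poly_Mapping.single (expo 0 0 0 1) (?l 0 0 0 1)"
  proof (rule poly_mapping_eqI)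
    fix m
    show "poly_mapping.lookup h m = poly_mapping.lookup (Poly_Mapping.single (expo 1 0 0 0) (?l 1 0 0 0)
      + Poly_Mapping.single (expo 0 1 0 0) (?l 0 1 0 0)
      + Poly_Mapping.single (expo 0 0 1 0) (?l 0 0 1 0) + Poly_Mapping.single (expo 0 0 0 1) (?l 0 0 0 1)) m"
    proof (cases "m \<in> {expo 1 0 0 0, expo 0 1 0 0, expo 0 0 1 0, expo 0 0 0 1}")
      case True
      then show ?thesis
        by (elim insertE) (simp_all add: lookup_add lookup_single expo_eq_iff)
    next
      case False
      then have "m \<notin> Poly_Mapping.keys h"
        using h exponent_deg_1[of m] by (auto simp: deg_part_eq)
      then show ?thesis
        using False by (auto simp: lookup_add lookup_single in_keys_iff when_def)
    qed
  qed
  then show "h = directional_derivative (?l 0 0 1 0) (- ?l 0 0 0 1) (?l 1 0 0 0) (- ?l 0 1 0 0) quadric"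
    by (simp add: directional_derivative_def pdq mon4_def const_poly_def mult_single single_uminus algebra_simps)
qed

text \<open>
  By the product rule a derivation is linear modulo \<open>J\<close> on \<open>J\<close>, and one with constant coefficients lowers
  degrees by one.
\<close>

lemma hom_lift_diff_derivative:
  assumes J: "poly_ideal J" and \<psi>: "hom_lift J (- 1) \<psi>"
  shows "hom_lift J (- 1) (\<lambda>f. \<psi> f - directional_derivative \<alpha> \<beta> \<gamma> \<delta> f)"
  unfolding hom_lift_def
proof (intro conjI allI ballI)
  let ?D = "directional_derivative \<alpha> \<beta> \<gamma> \<delta>"
  show "\<psi> (f + g) - ?D (f + g) - (\<psi> f - ?D f + (\<psi> g - ?D g)) \<in> J" if "f \<in> J" "g \<in> J" for f g
    using hom_lift_add[OF \<psi> that] by (simp add: directional_derivative_add algebra_simps)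
  show "\<psi> (a * f) - ?D (a * f) - a * (\<psi> f - ?D f) \<in> J" if "f \<in> J" for a f
    using poly_ideal_diff[OF J hom_lift_mult[OF \<psi> that, of a] poly_ideal_mult[OF J that, of "?D a"]]
    by (simp add: directional_derivative_mult algebra_simps)
  show "\<exists>g\<in>deg_part (e + - 1). \<psi> f - ?D f - g \<in> J" if f: "f \<in> J \<inter> deg_part e" for e f
  proof -
    obtain g where g: "g \<in> deg_part (e + - 1)" "\<psi> f - g \<in> J"
      using hom_lift_deg[OF \<psi>] f by blast
    have "g + const_poly (- 1) * ?D f \<in> deg_part (e + - 1)"
      using f directional_derivative_deg_part[of f e \<alpha> \<beta> \<gamma> \<delta>]
      by (intro deg_part_add g deg_part_const_mult) simp
    moreover have "const_poly (- 1) = (- 1 :: 'a poly4)"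
      by (simp add: const_poly_def single_uminus)
    ultimately show ?thesis
      using g(2) by (intro bexI[of _ "g + const_poly (- 1) * ?D f"]) simp_all
  qed
qed

text \<open>
  For \<open>d = - 1\<close> subtract the derivation that agrees with \<open>\<psi>\<close> on the quadric, and apply
  \<open>negative_hom_lift_zero\<close> to the difference.
\<close>

lemma (in corner_ideal) negative_hom_lift_is_derivative:
  assumes \<psi>: "hom_lift J d \<psi>" and d: "d < 0"
  obtains \<alpha> \<beta> \<gamma> \<delta> where "\<And>f. f \<in> J \<Longrightarrow> \<psi> f - directional_derivative \<alpha> \<beta> \<gamma> \<delta> f \<in> J"
proof (cases "d = - 1")
  case True
  with \<psi> have \<psi>1: "hom_lift J (- 1) \<psi>" by simp
  obtain h where h: "h \<in> deg_part (2 + - 1)" "\<psi> quadric - h \<in> J"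
    by (rule hom_lift_deg[OF \<psi>1 generators(3) quadric_deg_part])
  then have "h \<in> deg_part 1" by simp
  then obtain \<alpha> \<beta> \<gamma> \<delta> where "h = directional_derivative \<alpha> \<beta> \<gamma> \<delta> quadric"
    by (rule linear_form_eq_derivative_quadric)
  with h(2) have q: "\<psi> quadric - directional_derivative \<alpha> \<beta> \<gamma> \<delta> quadric \<in> J" by simp
  show ?thesis
    by (rule that[of \<alpha> \<beta> \<gamma> \<delta>], rule negative_hom_lift_zero[OF hom_lift_diff_derivative[OF J \<psi>1]])
       (simp_all add: q)
next
  case False
  have "directional_derivative 0 0 0 0 f = 0" for f :: "'k poly4"
    by (simp add: directional_derivative_def const_poly_def)
  with False show ?thesis
    using negative_hom_lift_zero[OF \<psi> d] that[of 0 0 0 0] by simp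
qed

section \<open>Cosets, maximal ideal and socle of the quotient\<close>

lemma coset_eq_iff:
  assumes J: "poly_ideal J"
  shows "J +>\<^bsub>S_ring\<^esub> f = J +>\<^bsub>S_ring\<^esub> g \<longleftrightarrow> f - g \<in> J"
proof -
  have coset: "J +>\<^bsub>S_ring\<^esub> f = {h. h - f \<in> J}" for f
  proof (intro Set.set_eqI iffI)
    fix h assume "h \<in> J +>\<^bsub>S_ring\<^esub> f"
    then obtain k where "k \<in> J" "h = k + f" unfolding a_r_coset_def' by auto
    then show "h \<in> {h. h - f \<in> J}" by simp
  next
    fix h assume "h \<in> {h. h - f \<in> J}"
    then show "h \<in> J +>\<^bsub>S_ring\<^esub> f"
      unfolding a_r_coset_def' by (intro UN_I[of "h - f"]) simp_all
  qed
  show ?thesis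
  proof
    have "f \<in> J +>\<^bsub>S_ring\<^esub> f" unfolding coset using poly_ideal_zero[OF J] by simp
    also assume "J +>\<^bsub>S_ring\<^esub> f = J +>\<^bsub>S_ring\<^esub> g"
    finally show "f - g \<in> J" unfolding coset by simp
  next
    assume fg: "f - g \<in> J"
    show "J +>\<^bsub>S_ring\<^esub> f = J +>\<^bsub>S_ring\<^esub> g"
      unfolding coset
      using poly_ideal_mod_trans[OF J _ fg] poly_ideal_mod_trans[OF J _ poly_ideal_mod_sym[OF J fg]] by blast
  qed
qed

lemma Quot_simps:
  assumes J: "poly_ideal J"
  shows "carrier (S_ring Quot J) = range (\<lambda>f. J +>\<^bsub>S_ring\<^esub> f)"
    and "\<zero>\<^bsub>S_ring Quot J\<^esub> = J +>\<^bsub>S_ring\<^esub> 0"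
    and "\<one>\<^bsub>S_ring Quot J\<^esub> = J +>\<^bsub>S_ring\<^esub> 1"
    and "(J +>\<^bsub>S_ring\<^esub> f) \<oplus>\<^bsub>S_ring Quot J\<^esub> (J +>\<^bsub>S_ring\<^esub> g) = J +>\<^bsub>S_ring\<^esub> (f + g)"
    and "(J +>\<^bsub>S_ring\<^esub> f) \<otimes>\<^bsub>S_ring Quot J\<^esub> (J +>\<^bsub>S_ring\<^esub> g) = J +>\<^bsub>S_ring\<^esub> (f * g)"
proof -
  interpret ideal J S_ring using J by (simp add: ideal_S_ring_iff)
  show "carrier (S_ring Quot J) = range (\<lambda>f. J +>\<^bsub>S_ring\<^esub> f)"
    by (auto simp: FactRing_def A_RCOSETS_def')
  show "\<zero>\<^bsub>S_ring Quot J\<^esub> = J +>\<^bsub>S_ring\<^esub> 0"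
    by (simp add: FactRing_def a_r_coset_def')
  show "\<one>\<^bsub>S_ring Quot J\<^esub> = J +>\<^bsub>S_ring\<^esub> 1"
    by (simp add: FactRing_def)
  show "(J +>\<^bsub>S_ring\<^esub> f) \<oplus>\<^bsub>S_ring Quot J\<^esub> (J +>\<^bsub>S_ring\<^esub> g) = J +>\<^bsub>S_ring\<^esub> (f + g)"
    using ring_hom_add[OF rcos_ring_hom, of f g] by simp
  show "(J +>\<^bsub>S_ring\<^esub> f) \<otimes>\<^bsub>S_ring Quot J\<^esub> (J +>\<^bsub>S_ring\<^esub> g) = J +>\<^bsub>S_ring\<^esub> (f * g)"
    using ring_hom_mult[OF rcos_ring_hom, of f g] by simp
qed

abbreviation origin_ideal :: "'k::field poly4 set" where
  "origin_ideal \<equiv> vanish_ideal {(0, 0)}"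

lemma poly_ideal_origin: "poly_ideal origin_ideal"
  by (rule poly_ideal_vanish_ideal) simp

lemma indet_in_origin: "indet_poly v \<in> origin_ideal"
  by (cases v) (auto intro!: vanish_idealI simp: indet_poly_eq_mon4 toric_coeff_mon4)

lemma one_notin_origin: "(1 :: 'k::field poly4) \<notin> origin_ideal"
  using vanish_idealD[of "1 :: 'k poly4" "{(0, 0)}" 0 0 0] toric_coeff_mon4[where ?'a = 'k, of 0 0 0 0 0 0 0]
  by (auto simp: mon4_0)

lemma minus_const_in_origin: "f - const_poly (toric_coeff f 0 0 0) \<in> origin_ideal"
proof (rule vanish_idealI, clarsimp)
  fix e
  show "toric_coeff (f - const_poly (toric_coeff f 0 0 0)) 0 0 e = 0"
    by (cases "e = 0") (simp_all add: toric_coeff_diff const_poly_def toric_coeff_single toric_coeff_large grading_defs)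
qed

text \<open>
  The origin ideal is \<open>V(D)\<close> for \<open>D = {(0, 0)}\<close>; a monomial of any other bidegree is divisible by a
  variable.
\<close>

lemma origin_ideal_subset:
  assumes L: "poly_ideal L" and v: "\<And>v. indet_poly v \<in> L"
  shows "origin_ideal \<subseteq> L"
proof (rule vanish_ideal_subset[OF L])
  show "quadric \<in> L"
    unfolding quadric_eq[symmetric] by (intro poly_ideal_diff[OF L] poly_ideal_mult[OF L] v)
  have xy: "mon4 a b 0 0 \<in> L" if "a + b = 1" for a b
    using that v[of IX] v[of IY] by (cases a) (auto simp: indet_poly_eq_mon4)
  have zw: "mon4 0 0 a b \<in> L" if "a + b = 1" for a b
    using that v[of IZ] v[of IW] by (cases a) (auto simp: indet_poly_eq_mon4)
  fix m assume "(xy_deg m, zw_deg m) \<notin> {(0, 0)}"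
  then have "1 \<le> xy_deg m \<or> 1 \<le> zw_deg m" by force
  then show "Poly_Mapping.single m 1 \<in> L"
    using single_mem_if_xy_powers[OF L xy, of 1 m] single_mem_if_zw_powers[OF L zw, of 1 m] by blast
qed

lemma poly_ideal_preimage:
  assumes J: "poly_ideal J" and N: "ideal N (S_ring Quot J)"
  shows "poly_ideal {f. J +>\<^bsub>S_ring\<^esub> f \<in> N}"
proof -
  interpret N: ideal N "S_ring Quot J" by (rule N)
  show ?thesis
  proof (rule poly_idealI)
    show "0 \<in> {f. J +>\<^bsub>S_ring\<^esub> f \<in> N}"
      using additive_subgroup.zero_closed[OF N.is_additive_subgroup] by (simp add: Quot_simps[OF J])
    show "f + g \<in> {f. J +>\<^bsub>S_ring\<^esub> f \<in> N}" if "f \<in> {f. J +>\<^bsub>S_ring\<^esub> f \<in> N}" "g \<in> {f. J +>\<^bsub>S_ring\<^esub> f \<in> N}" for f g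
      using additive_subgroup.a_closed[OF N.is_additive_subgroup, of "J +>\<^bsub>S_ring\<^esub> f" "J +>\<^bsub>S_ring\<^esub> g"] that
      by (simp add: Quot_simps[OF J])
    show "a * f \<in> {f. J +>\<^bsub>S_ring\<^esub> f \<in> N}" if "f \<in> {f. J +>\<^bsub>S_ring\<^esub> f \<in> N}" for a f
      using N.I_l_closed[of "J +>\<^bsub>S_ring\<^esub> f" "J +>\<^bsub>S_ring\<^esub> a"] that
      by (simp add: Quot_simps[OF J])
  qed
qed

text \<open>
  The image of the origin ideal is maximal, as modulo it every element is a constant. It is the only
  maximal ideal: a maximal ideal is prime, so it contains the nilpotent classes of the variables and
  with them the whole image.
\<close>

lemma max_ideal_quotient:
  fixes J :: "'k::field poly4 set"
  assumes J: "poly_ideal J" and J0: "J \<subseteq> origin_ideal" and nilp: "\<And>v. \<exists>n. indet_poly v ^ n \<in> J"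
  shows "max_ideal (S_ring Quot J) = (\<lambda>f. J +>\<^bsub>S_ring\<^esub> f) ` origin_ideal"
    (is "_ = ?M")
proof -
  let ?Q = "S_ring Quot J" and ?cl = "\<lambda>f. J +>\<^bsub>S_ring\<^esub> f"
  have Jid: "ideal J S_ring" using J by (simp add: ideal_S_ring_iff)
  have cring: "cring ?Q" by (rule ideal.quotient_is_cring[OF Jid cring_S_ring])
  have Mid: "ideal ?M ?Q"
    by (rule ring.ring_ideal_imp_quot_ideal[OF ring_S_ring Jid]) (simp add: ideal_S_ring_iff poly_ideal_origin)
  have one: "?cl 1 \<notin> ?M"
  proof
    assume "?cl 1 \<in> ?M"
    then obtain f where f: "f \<in> origin_ideal" "1 - f \<in> J" using coset_eq_iff[OF J] by auto
    have "(1 :: 'k poly4) \<in> origin_ideal"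
      by (rule poly_ideal_mod_mem[OF poly_ideal_origin subsetD[OF J0 f(2)] f(1)])
    then show False using one_notin_origin by contradiction
  qed
  have proper: "N = carrier ?Q" if N: "ideal N ?Q" and "?cl 1 \<in> N" for N
    using ideal.one_imp_carrier[OF N] that Quot_simps(3)[OF J] by simp
  have dichotomy: "N = ?M \<or> N = carrier ?Q" if N: "ideal N ?Q" and MN: "?M \<subseteq> N" for N
  proof (rule ccontr)
    assume neg: "\<not> (N = ?M \<or> N = carrier ?Q)"
    have L: "poly_ideal {f. ?cl f \<in> N}" by (rule poly_ideal_preimage[OF J N])
    obtain X where X: "X \<in> N" "X \<notin> ?M" using neg MN by blast
    then have "X \<in> carrier ?Q"
      using additive_subgroup.a_subset[OF ideal.axioms(1)[OF N]] by blast
    then obtain f where f: "X = ?cl f" using Quot_simps(1)[OF J] by auto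
    let ?c = "toric_coeff f 0 0 0"
    have fc: "f - const_poly ?c \<in> {f. ?cl f \<in> N}" using minus_const_in_origin[of f] MN by blast
    have "f \<in> {f. ?cl f \<in> N}" using X f by simp
    then have "const_poly ?c \<in> {f. ?cl f \<in> N}"
      using poly_ideal_diff[OF L _ fc, of f] by simp
    then have c: "const_poly (inverse ?c) * const_poly ?c \<in> {f. ?cl f \<in> N}" by (rule poly_ideal_mult[OF L])
    have "?c \<noteq> 0"
      using minus_const_in_origin[of f] X(2) f by (auto simp: const_poly_def)
    then have "const_poly (inverse ?c) * const_poly ?c = 1"
      by (simp add: const_poly_def mult_single)
    with c have "?cl 1 \<in> N" by simp
    with neg proper[OF N] show False by blast
  qed
  have "maximalideal ?M ?Q"
  proof (rule maximalidealI[OF Mid])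
    show "carrier ?Q \<noteq> ?M" using one Quot_simps(1)[OF J] by blast
  qed (use dichotomy in blast)
  moreover have "N = ?M" if N: "maximalideal N ?Q" for N
  proof -
    interpret N: primeideal N ?Q by (rule cring.maximalideal_prime[OF cring N])
    have Nid: "ideal N ?Q" by (rule N.is_ideal)
    have L: "poly_ideal {f. ?cl f \<in> N}" by (rule poly_ideal_preimage[OF J Nid])
    have JL: "J \<subseteq> {f. ?cl f \<in> N}"
    proof
      fix f assume "f \<in> J"
      then have "?cl f = ?cl 0" using coset_eq_iff[OF J, of f 0] by simp
      then show "f \<in> {f. ?cl f \<in> N}" using poly_ideal_zero[OF L] by simp
    qed
    have rad: "?cl v \<in> N" if "?cl (v ^ n) \<in> N" for v n
      using that
    proof (induction n)
      case 0
      then show ?case using proper[OF Nid] N.I_notcarr by simp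
    next
      case (Suc n)
      then have "?cl v \<otimes>\<^bsub>?Q\<^esub> ?cl (v ^ n) \<in> N" by (simp add: Quot_simps[OF J])
      then show ?case
        using N.I_prime[of "?cl v" "?cl (v ^ n)"] Suc.IH Quot_simps(1)[OF J] by blast
    qed
    have "indet_poly v \<in> {f. ?cl f \<in> N}" for v
      using nilp[of v] JL rad by blast
    then have "?M \<subseteq> N" using origin_ideal_subset[OF L] by blast
    with dichotomy[OF Nid] N.I_notcarr show ?thesis by blast
  qed
  ultimately show ?thesis
    unfolding max_ideal_def by (intro the_equality)
qed

text \<open>
  The multipliers that send \<open>g\<close> into \<open>J\<close> form an ideal, so it is enough to test the generators of the
  origin ideal.
\<close>

lemma socle_quotient_iff:
  assumes J: "poly_ideal J" and J0: "J \<subseteq> origin_ideal" and nilp: "\<And>v. \<exists>n. indet_poly v ^ n \<in> J"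
  shows "J +>\<^bsub>S_ring\<^esub> g \<in> socle (S_ring Quot J) \<longleftrightarrow> (\<forall>v. indet_poly v * g \<in> J)"
proof -
  have "J +>\<^bsub>S_ring\<^esub> g \<in> socle (S_ring Quot J) \<longleftrightarrow> (\<forall>f\<in>origin_ideal. f * g \<in> J)"
    using coset_eq_iff[OF J, of _ 0]
    by (auto simp: socle_def max_ideal_quotient[OF assms] Quot_simps[OF J])
  also have "\<dots> \<longleftrightarrow> (\<forall>v. indet_poly v * g \<in> J)"
  proof
    assume v: "\<forall>v. indet_poly v * g \<in> J"
    have "poly_ideal {f. f * g \<in> J}"
      by (rule poly_idealI)
         (auto simp: distrib_right mult.assoc intro: poly_ideal_zero[OF J] poly_ideal_add[OF J] poly_ideal_mult[OF J])
    then have "origin_ideal \<subseteq> {f. f * g \<in> J}" using v by (intro origin_ideal_subset) auto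
    then show "\<forall>f\<in>origin_ideal. f * g \<in> J" by blast
  qed (use indet_in_origin in blast)
  finally show ?thesis .
qed

section \<open>Tangents and trivial tangents\<close>

definition derivation_mod :: "'k::field poly4 set \<Rightarrow> ('k poly4 \<Rightarrow> 'k poly4) \<Rightarrow> bool" where
  "derivation_mod J \<delta> \<longleftrightarrow>
     (\<forall>f g. \<delta> (f + g) - (\<delta> f + \<delta> g) \<in> J) \<and>
     (\<forall>c f. \<delta> (const_poly c * f) - const_poly c * \<delta> f \<in> J) \<and>
     (\<forall>f g. \<delta> (f * g) - (f * \<delta> g + g * \<delta> f) \<in> J)"

lemma coset_derivations_iff:
  assumes J: "poly_ideal J"
  shows "(\<lambda>f. J +>\<^bsub>S_ring\<^esub> \<delta> f) \<in> derivations J \<longleftrightarrow> derivation_mod J \<delta>"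
  by (auto simp: derivations_def derivation_mod_def Quot_simps[OF J] coset_eq_iff[OF J])

lemma derivations_lift:
  assumes J: "poly_ideal J" and D: "D \<in> derivations J"
  obtains \<delta> where "D = (\<lambda>f. J +>\<^bsub>S_ring\<^esub> \<delta> f)" "derivation_mod J \<delta>"
proof -
  have "\<exists>g. D f = J +>\<^bsub>S_ring\<^esub> g" for f
  proof -
    have "D f \<in> carrier (S_ring Quot J)" using D by (simp add: derivations_def Pi_iff)
    then show ?thesis unfolding Quot_simps(1)[OF J] by (rule rangeE) (rule exI)
  qed
  then obtain \<delta> where "D = (\<lambda>f. J +>\<^bsub>S_ring\<^esub> \<delta> f)" by metis
  with D coset_derivations_iff[OF J] show ?thesis using that by auto
qed

lemma derivation_mod_add:
  assumes J: "poly_ideal J" and "derivation_mod J \<delta>" "derivation_mod J \<epsilon>"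
  shows "derivation_mod J (\<lambda>f. \<delta> f + \<epsilon> f)"
  unfolding derivation_mod_def
proof (intro conjI allI)
  fix f g c
  note add = poly_ideal_add[OF J]
  show "\<delta> (f + g) + \<epsilon> (f + g) - (\<delta> f + \<epsilon> f + (\<delta> g + \<epsilon> g)) \<in> J"
    using add[of "\<delta> (f + g) - (\<delta> f + \<delta> g)" "\<epsilon> (f + g) - (\<epsilon> f + \<epsilon> g)"] assms
    by (simp add: derivation_mod_def algebra_simps)
  show "\<delta> (const_poly c * f) + \<epsilon> (const_poly c * f) - const_poly c * (\<delta> f + \<epsilon> f) \<in> J"
    using add[of "\<delta> (const_poly c * f) - const_poly c * \<delta> f" "\<epsilon> (const_poly c * f) - const_poly c * \<epsilon> f"] assms
    by (simp add: derivation_mod_def algebra_simps)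
  show "\<delta> (f * g) + \<epsilon> (f * g) - (f * (\<delta> g + \<epsilon> g) + g * (\<delta> f + \<epsilon> f)) \<in> J"
    using add[of "\<delta> (f * g) - (f * \<delta> g + g * \<delta> f)" "\<epsilon> (f * g) - (f * \<epsilon> g + g * \<epsilon> f)"] assms
    by (simp add: derivation_mod_def algebra_simps)
qed

lemma derivation_mod_uminus:
  assumes J: "poly_ideal J" and "derivation_mod J \<delta>"
  shows "derivation_mod J (\<lambda>f. - \<delta> f)"
  unfolding derivation_mod_def
proof (intro conjI allI)
  fix f g c
  note neg = poly_ideal_uminus[OF J]
  show "- \<delta> (f + g) - (- \<delta> f + - \<delta> g) \<in> J"
    using neg[of "\<delta> (f + g) - (\<delta> f + \<delta> g)"] assms by (simp add: derivation_mod_def algebra_simps)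
  show "- \<delta> (const_poly c * f) - const_poly c * - \<delta> f \<in> J"
    using neg[of "\<delta> (const_poly c * f) - const_poly c * \<delta> f"] assms by (simp add: derivation_mod_def algebra_simps)
  show "- \<delta> (f * g) - (f * - \<delta> g + g * - \<delta> f) \<in> J"
    using neg[of "\<delta> (f * g) - (f * \<delta> g + g * \<delta> f)"] assms by (simp add: derivation_mod_def algebra_simps)
qed

text \<open>
  The trivial tangents are closed under sums and negatives, since the derivations are.
\<close>

lemma trivial_tangents_coset:
  assumes J: "poly_ideal J" and \<phi>: "\<phi> \<in> trivial_tangents J"
  shows "trivial_tangents J #>\<^bsub>tangent_group J\<^esub> \<phi> = trivial_tangents J"
proof -
  let ?t = "\<lambda>\<delta>. \<lambda>f\<in>J. J +>\<^bsub>S_ring\<^esub> \<delta> f"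
  have triv: "\<chi> \<in> trivial_tangents J \<longleftrightarrow> (\<exists>\<delta>. derivation_mod J \<delta> \<and> \<chi> = ?t \<delta>)" for \<chi>
  proof
    assume "\<chi> \<in> trivial_tangents J"
    then obtain D where D: "D \<in> derivations J" "\<chi> = restrict D J" by (auto simp: trivial_tangents_def)
    from derivations_lift[OF J D(1)] D(2) show "\<exists>\<delta>. derivation_mod J \<delta> \<and> \<chi> = ?t \<delta>" by metis
  next
    assume "\<exists>\<delta>. derivation_mod J \<delta> \<and> \<chi> = ?t \<delta>"
    then show "\<chi> \<in> trivial_tangents J"
      using coset_derivations_iff[OF J] by (auto simp: trivial_tangents_def)
  qed
  have mult: "?t \<delta> \<otimes>\<^bsub>tangent_group J\<^esub> ?t \<epsilon> = ?t (\<lambda>f. \<delta> f + \<epsilon> f)" for \<delta> \<epsilon>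
    by (auto simp: tangent_group_def Quot_simps[OF J] intro!: restrict_ext)
  obtain \<epsilon> where \<epsilon>: "derivation_mod J \<epsilon>" "\<phi> = ?t \<epsilon>" using \<phi> triv by blast
  show ?thesis
  proof
    show "trivial_tangents J #>\<^bsub>tangent_group J\<^esub> \<phi> \<subseteq> trivial_tangents J"
    proof
      fix \<chi> assume "\<chi> \<in> trivial_tangents J #>\<^bsub>tangent_group J\<^esub> \<phi>"
      then obtain \<chi>' where "\<chi>' \<in> trivial_tangents J" and \<chi>: "\<chi> = \<chi>' \<otimes>\<^bsub>tangent_group J\<^esub> \<phi>"
        by (auto simp: r_coset_def)
      then obtain \<delta> where \<delta>: "derivation_mod J \<delta>" "\<chi>' = ?t \<delta>" unfolding triv by blast
      have "\<chi> = ?t (\<lambda>f. \<delta> f + \<epsilon> f)" unfolding \<chi> \<delta>(2) \<epsilon>(2) by (rule mult)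
      with derivation_mod_add[OF J \<delta>(1) \<epsilon>(1)] show "\<chi> \<in> trivial_tangents J"
        unfolding triv by (intro exI conjI)
    qed
    show "trivial_tangents J \<subseteq> trivial_tangents J #>\<^bsub>tangent_group J\<^esub> \<phi>"
    proof
      fix \<chi> assume "\<chi> \<in> trivial_tangents J"
      then obtain \<delta> where \<delta>: "derivation_mod J \<delta>" "\<chi> = ?t \<delta>" using triv by blast
      have "?t (\<lambda>f. \<delta> f + - \<epsilon> f) \<in> trivial_tangents J"
        unfolding triv
        by (intro exI conjI, rule derivation_mod_add[OF J \<delta>(1) derivation_mod_uminus[OF J \<epsilon>(1)]], rule refl)
      moreover have "\<chi> = ?t (\<lambda>f. \<delta> f + - \<epsilon> f) \<otimes>\<^bsub>tangent_group J\<^esub> \<phi>"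
        unfolding \<epsilon>(2) mult \<delta>(2) by simp
      ultimately show "\<chi> \<in> trivial_tangents J #>\<^bsub>tangent_group J\<^esub> \<phi>"
        unfolding r_coset_def by (intro UN_I[where a = "?t (\<lambda>f. \<delta> f + - \<epsilon> f)"]) simp_all
    qed
  qed
qed

lemma zero_tangents_deg:
  assumes J: "poly_ideal J"
  shows "(\<lambda>f\<in>J. J +>\<^bsub>S_ring\<^esub> 0) \<in> tangents_deg J d"
proof -
  have "J +>\<^bsub>S_ring\<^esub> 0 \<in> quot_deg_part J e" for e
    unfolding quot_deg_part_def using zero_deg_part by blast
  then show ?thesis
    using poly_ideal_add[OF J] poly_ideal_mult[OF J]
    by (auto simp: tangents_deg_def tangents_def Quot_simps[OF J])
qed

text \<open>
  The degree \<open>d\<close> piece of the cokernel is nonempty because of the zero tangent.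
\<close>

lemma trivial_negative_tangentsI:
  assumes J: "poly_ideal J"
    and triv: "\<And>d. d < 0 \<Longrightarrow> tangents_deg J d \<subseteq> trivial_tangents J"
  shows "trivial_negative_tangents J"
  unfolding trivial_negative_tangents_def
proof (intro allI impI)
  fix d :: int assume "d < 0"
  then have "trivial_tangents J #>\<^bsub>tangent_group J\<^esub> \<phi> = trivial_tangents J"
    if "\<phi> \<in> tangents_deg J d" for \<phi>
    using trivial_tangents_coset[OF J] triv that by blast
  moreover have "tangents_deg J d \<noteq> {}" using zero_tangents_deg[OF J] by blast
  ultimately have "T1_deg J d = {trivial_tangents J}"
    by (auto simp: T1_deg_def)
  then show "T1_deg J d = {\<one>\<^bsub>T1 J\<^esub>}" by (simp add: T1_def)
qed

lemma tangents_deg_lift: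
  assumes J: "poly_ideal J" and \<phi>: "\<phi> \<in> tangents_deg J d"
  obtains \<psi> where "hom_lift J d \<psi>" "\<phi> = (\<lambda>f\<in>J. J +>\<^bsub>S_ring\<^esub> \<psi> f)"
proof -
  have \<phi>J: "\<phi> \<in> J \<rightarrow>\<^sub>E range (\<lambda>f. J +>\<^bsub>S_ring\<^esub> f)"
    using \<phi> by (simp add: tangents_deg_def tangents_def Quot_simps(1)[OF J])
  then have "\<forall>f\<in>J. \<exists>g. \<phi> f = J +>\<^bsub>S_ring\<^esub> g" by (auto simp: PiE_iff)
  then obtain \<psi> where \<psi>: "\<And>f. f \<in> J \<Longrightarrow> \<phi> f = J +>\<^bsub>S_ring\<^esub> \<psi> f" by metis
  have "hom_lift J d \<psi>"
    unfolding hom_lift_def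
  proof (intro conjI allI ballI)
    show "\<psi> (f + g) - (\<psi> f + \<psi> g) \<in> J" if "f \<in> J" "g \<in> J" for f g
    proof -
      have "\<phi> (f + g) = \<phi> f \<oplus>\<^bsub>S_ring Quot J\<^esub> \<phi> g"
        using \<phi> that by (simp add: tangents_deg_def tangents_def)
      then show ?thesis
        using that poly_ideal_add[OF J that] by (simp add: \<psi> Quot_simps[OF J] coset_eq_iff[OF J])
    qed
    show "\<psi> (a * f) - a * \<psi> f \<in> J" if "f \<in> J" for a f
    proof -
      have "\<phi> (a * f) = (J +>\<^bsub>S_ring\<^esub> a) \<otimes>\<^bsub>S_ring Quot J\<^esub> \<phi> f"
        using \<phi> that by (simp add: tangents_deg_def tangents_def)
      then show ?thesis
        using that poly_ideal_mult[OF J that] by (simp add: \<psi> Quot_simps[OF J] coset_eq_iff[OF J])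
    qed
    show "\<exists>g\<in>deg_part (e + d). \<psi> f - g \<in> J" if "f \<in> J \<inter> deg_part e" for e f
    proof -
      have "\<phi> f \<in> quot_deg_part J (e + d)" using \<phi> that by (auto simp: tangents_deg_def)
      then obtain g where "g \<in> deg_part (e + d)" "\<phi> f = J +>\<^bsub>S_ring\<^esub> g"
        by (auto simp: quot_deg_part_def)
      with that \<psi>[of f] show ?thesis by (auto simp: coset_eq_iff[OF J] dest: poly_ideal_mod_sym[OF J])
    qed
  qed
  moreover have "\<phi> = (\<lambda>f\<in>J. J +>\<^bsub>S_ring\<^esub> \<psi> f)"
    using \<phi>J \<psi> by (intro ext) (auto simp: PiE_iff extensional_def)
  ultimately show ?thesis by (rule that)
qed

lemma (in corner_ideal) trivial_negative_tangents: "trivial_negative_tangents J"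
proof (rule trivial_negative_tangentsI[OF J], rule subsetI)
  fix d :: int and \<phi> assume d: "d < 0" and "\<phi> \<in> tangents_deg J d"
  then obtain \<psi> where \<psi>: "hom_lift J d \<psi>" "\<phi> = (\<lambda>f\<in>J. J +>\<^bsub>S_ring\<^esub> \<psi> f)"
    using tangents_deg_lift[OF J] by blast
  obtain \<alpha> \<beta> \<gamma> \<delta> where D: "\<And>f. f \<in> J \<Longrightarrow> \<psi> f - directional_derivative \<alpha> \<beta> \<gamma> \<delta> f \<in> J"
    using negative_hom_lift_is_derivative[OF \<psi>(1) d] by blast
  have "(\<lambda>f. J +>\<^bsub>S_ring\<^esub> directional_derivative \<alpha> \<beta> \<gamma> \<delta> f) \<in> derivations J"
    using poly_ideal_zero[OF J]
    by (simp add: coset_derivations_iff[OF J] derivation_mod_def directional_derivative_add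
        directional_derivative_const directional_derivative_mult)
  moreover have "\<phi> = restrict (\<lambda>f. J +>\<^bsub>S_ring\<^esub> directional_derivative \<alpha> \<beta> \<gamma> \<delta> f) J"
    unfolding \<psi>(2) using D by (intro restrict_ext) (simp add: coset_eq_iff[OF J])
  ultimately show "\<phi> \<in> trivial_tangents J" by (auto simp: trivial_tangents_def)
qed

lemma indet_power_in_ideal_I: "\<exists>n. indet_poly v ^ n \<in> ideal_I n1 n2"
proof -
  have pow: "mon4 a b c d ^ n = mon4 (a * n) (b * n) (c * n) (d * n)" for a b c d n
    by (induction n) (simp_all add: mon4_0 mon4_mult)
  have "indet_poly v ^ (n1 + n2) \<in> ideal_I n1 n2"
    by (cases v) (auto simp: indet_poly_eq_mon4 pow ideal_I_eq_vanish toric_coeff_mon4 intro!: vanish_idealI)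
  then show ?thesis ..
qed

section \<open>Triviality of the negative tangents\<close>

theorem corollary5p6:
  fixes n1 n2 r :: nat
    and s :: "nat \<Rightarrow> 'k::{alg_closed_field, field_char_0} poly4"
    and I J' :: "'k poly4 set"
  assumes "n1 \<ge> 3" and "n2 \<ge> 3" and "r \<ge> 1"
    and "I = ideal_I n1 n2"
    and "J' = I <+>\<^bsub>S_ring\<^esub> Idl\<^bsub>S_ring\<^esub> (s ` {1..r})"
    and "\<forall>i\<in>{1..r}. I +>\<^bsub>S_ring\<^esub> s i \<in> socle (S_ring Quot I)"
    and "socle (S_ring Quot J') = quot_bideg_part J' (n1 - 1) (n2 - 1)"
  shows "trivial_negative_tangents J'"
proof -
  have I: "poly_ideal I" using assms(4) poly_ideal_ideal_I by simp
  have I_le: "I \<subseteq> J'" and J: "poly_ideal J'"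
    unfolding assms(5) by (intro subset_set_add poly_ideal_set_add I poly_ideal_genideal)+
  have I_off: "I \<subseteq> vanish_ideal (off_corner n1 n2)"
    by (auto simp: assms(4) ideal_I_eq_vanish vanish_ideal_def off_corner_def)
  have "(0, 0) \<in> off_corner n1 n2" using assms(1,2) by (simp add: off_corner_def)
  then have off_origin: "vanish_ideal (off_corner n1 n2) \<subseteq> origin_ideal"
    unfolding vanish_ideal_def by blast
  have nilp: "\<exists>n. indet_poly v ^ n \<in> I" for v :: indet
    using indet_power_in_ideal_I assms(4) by blast
  have s_off: "s k \<in> vanish_ideal (off_corner n1 n2)" if "k \<in> {1..r}" for k
  proof (rule vanish_idealI)
    fix i j e assume ij: "(i, j) \<in> off_corner n1 n2"
    have vs: "indet_poly v * s k \<in> I" for v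
      using assms(6) that socle_quotient_iff[OF I _ nilp] I_off off_origin by blast
    \<comment> \<open>Off the corner one of \<open>y\<close> and \<open>z\<close> stays in the box, and both act injectively.\<close>
    have "toric_coeff (mon4 0 1 0 0 * s k) (Suc i) j e = 0" if "Suc i < n1"
      using vs[of IY] that ij
      by (auto simp: assms(4) ideal_I_eq_vanish indet_poly_eq_mon4 off_corner_def dest: vanish_idealD)
    moreover have "toric_coeff (mon4 0 0 1 0 * s k) i (Suc j) e = 0" if "Suc j < n2"
      using vs[of IZ] that ij
      by (auto simp: assms(4) ideal_I_eq_vanish indet_poly_eq_mon4 off_corner_def dest: vanish_idealD)
    moreover have "Suc i < n1 \<or> Suc j < n2" using ij by (auto simp: off_corner_def)
    ultimately show "toric_coeff (s k) i j e = 0" by (auto simp: toric_coeff_mon4_mult)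
  qed
  have J_le: "J' \<subseteq> vanish_ideal (off_corner n1 n2)"
    unfolding assms(5) using s_off
    by (intro set_add_subset poly_ideal_off_corner I_off genideal_subset) auto
  interpret corner_ideal n1 n2 J'
  proof
    show "\<exists>h\<in>bideg_part (n1 - 1) (n2 - 1). g - h \<in> J'" if "\<And>v. indet_poly v * g \<in> J'" for g
    proof -
      have "J' +>\<^bsub>S_ring\<^esub> g \<in> socle (S_ring Quot J')"
        using socle_quotient_iff[OF J] that J_le off_origin nilp I_le by blast
      then show ?thesis
        using assms(7) by (auto simp: quot_bideg_part_def coset_eq_iff[OF J])
    qed
  qed (use assms(1,2,4) J I_le J_le in auto)
  show ?thesis by (rule trivial_negative_tangents)
qed

end
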